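(* Let $d\in\{2,3,\dots\}\cup\{\infty\}$ and let $\underline{A}=(A_1,\dots,A_d)$ be an ergodic coisometric row contraction on a complex separable Hilbert space $\mathcal{H}$ with $A_i^*\Omega_{\mathcal{H}}=\overline{\omega}_i\Omega_{\mathcal{H}}$ for all $i$, where $\Omega_{\mathcal{H}}\in\mathcal{H}$ is a unit vector and $\underline{\omega}\in\mathbb{C}^d$, $\sum_i|\omega_i|^2=1$. Let $\mathbf{w}:\hat{\mathcal{H}}\to\tilde{\mathcal{P}}$ be the intertwining unitary given by the infinite product formula, and let $\Gamma_A$, $\Gamma_\omega$, $V_i$, $\tilde V_i$ be as defined in the context. Put $$W=\Gamma_\omega\,\mathbf{w}\,\Gamma_A^{-1}:\ \mathcal{H}\oplus(\Gamma(\mathbb{C}^d)\otimes\mathcal{D}_A)\to\mathbb{C}\oplus(\Gamma(\mathbb{C}^d)\otimes\mathcal{D}_\omega).$$ Then $W$ is a unitary with $WV_i=\tilde V_iW$ for $i=1,\dots,d$ and $W\Omega_{\mathcal{H}}=1\in\mathbb{C}$, and its restriction $M_{\hat\Theta}:=W|_{\Gamma(\mathbb{C}^d)\otimes\mathcal{D}_A}$ is an isometry from $\Gamma(\mathbb{C}^d)\otimes\mathcal{D}_A$ into $\Gamma(\mathbb{C}^d)\otimes\mathcal{D}_\omega$ satisfying $$M_{\hat\Theta}(L_i\otimes\mathbf{1}_{\mathcal{D}_A})=(L_i\otimes\mathbf{1}_{\mathcal{D}_\omega})M_{\hat\Theta}\qquad(1\le i\le d),$$ i.e. $M_{\hat\Theta}$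 is a multi-analytic inner function.
   Context: Inner products are linear in the second argument. If $d=\infty$, infinite sums of operators are strong limits and $\mathbb{C}^d=\ell^2(\mathbb{N})$. Coisometric: $\sum_iA_iA_i^*=\mathbf{1}$. Ergodic: the only fixed points of $Z(x)=\sum_iA_ixA_i^*$ on $B(\mathcal{H})$ are scalar multiples of $\mathbf{1}$. Tensor product dilation: let $\mathcal{P}$ be a Hilbert space with orthonormal basis $\epsilon_1,\dots,\epsilon_d$, $\Omega_{\mathcal{P}}=\sum_i\overline{\omega}_i\epsilon_i$, and let $\mathcal{K}$ be a Hilbert space with unit vector $\Omega_{\mathcal{K}}$ and $u:\mathcal{H}\otimes\mathcal{P}\to\mathcal{H}\otimes\mathcal{K}$ an isometry with $u^*(h\otimes\Omega_{\mathcal{K}})=\sum_iA_i^*h\otimes\epsilon_i$ for all $h\in\mathcal{H}$ (these exist; then $u(\Omega_{\mathcal{H}}\otimes\Omega_{\mathcal{P}})=\Omega_{\mathcal{H}}\otimes\Omega_{\mathcal{K}}$). Let $\tilde{\mathcal{K}}=\bigotimes_1^\infty\mathcal{K}$ along $(\Omega_{\mathcal{K}})$ and $\tilde{\mathcal{P}}=\bigotimes_1^\infty\mathcal{P}$ along $(\Omega_{\mathcal{P}})$, with distinguished unit vectors $\Omega_{\tilde{\mathcal{K}}}$, $\Omega_{\tilde{\mathcal{P}}}$. Define isometries $t_i(h\otimes\tilde k)=u(h\otimes\epsilon_i)\otimes\tilde k\in(\mathcal{H}\otimes\mathcal{K})\otimes\tilde{\mathcal{K}}\simeq\mathcal{H}\otimes\tilde{\mathcal{K}}$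 and $s_i(\tilde k)=\epsilon_i\otimes\tilde k\in\mathcal{P}\otimes\tilde{\mathcal{P}}\simeq\tilde{\mathcal{P}}$. Identify $\mathcal{H}$ with $\mathcal{H}\otimes\Omega_{\tilde{\mathcal{K}}}$, and let $\hat{\mathcal{H}}\subset\mathcal{H}\otimes\tilde{\mathcal{K}}$ be the closed linear span of all $t_{\alpha_1}\cdots t_{\alpha_n}h$ with $h\in\mathcal{H}$, $n\ge0$; the $t_i$ are restricted to $\hat{\mathcal{H}}$. Intertwiner $\mathbf{w}$: let $u_{0n}$ be $u$ acting on $\mathcal{H}$ and the $n$-th tensor factor. For $\xi\in\mathcal{H}\otimes\mathcal{K}^{\otimes m}$ and $n\ge m$ consider $u_{0n}^*\cdots u_{01}^*(\xi\otimes\Omega_{\mathcal{K}}^{\otimes(n-m)})\in\mathcal{H}\otimes\mathcal{P}^{\otimes n}\subset\mathcal{H}\otimes\tilde{\mathcal{P}}$ (embedding by tensoring with $\Omega_{\mathcal{P}}$ in the remaining factors). It is a known theorem (Gohm) that, under the ergodicity assumption, the limit $n\to\infty$ exists and defines a partial isometry $\tilde{\mathbf{w}}:\mathcal{H}\otimes\tilde{\mathcal{K}}\to\mathcal{H}\otimes\tilde{\mathcal{P}}$ with initial space $\hat{\mathcal{H}}$ and final space $\Omega_{\mathcal{H}}\otimes\tilde{\mathcal{P}}\simeq\tilde{\mathcal{P}}$; $\mathbf{w}:\hat{\mathcal{H}}\to\tilde{\mathcal{P}}$ is the corresponding unitary restriction, and $\mathbf{w}t_i=s_i\mathbf{w}$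 for all $i$. Fock space dilations: $\Gamma(\mathbb{C}^d)=\mathbb{C}e_0\oplus\mathbb{C}^d\oplus(\mathbb{C}^d)^{\otimes2}\oplus\cdots$ with vacuum $e_0$, standard basis $e_1,\dots,e_d$ of $\mathbb{C}^d$ and $L_ix=e_i\otimes x$ ($L_ie_0=e_i$). $D_A=(\mathbf{1}-\underline{A}^*\underline{A})^{1/2}$ on $\bigoplus_1^d\mathcal{H}$ (with $\underline{A}:\bigoplus_1^d\mathcal{H}\to\mathcal{H}$ the row operator) is a projection with range $\mathcal{D}_A$. Popescu's minimal isometric dilation of $\underline{A}$ on $\mathcal{H}\oplus(\Gamma(\mathbb{C}^d)\otimes\mathcal{D}_A)$ is $V_i(h\oplus\xi)=A_ih\oplus[e_0\otimes D_A(0,\dots,0,h,0,\dots,0)+(L_i\otimes\mathbf{1})\xi]$ ($h$ in the $i$-th position). The same construction for the row $\underline{\omega}:\mathbb{C}^d\to\mathbb{C}$ gives isometries $\tilde V_i$ on $\mathbb{C}\oplus(\Gamma(\mathbb{C}^d)\otimes\mathcal{D}_\omega)$, where $\mathcal{D}_\omega=\mathbb{C}^d\ominus\mathbb{C}(\overline{\omega}_1,\dots,\overline{\omega}_d)^T$. By uniqueness of minimal isometric dilations there are unique unitaries $\Gamma_A:\hat{\mathcal{H}}\to\mathcal{H}\oplus(\Gamma(\mathbb{C}^d)\otimes\mathcal{D}_A)$, equal to the identity on $\mathcal{H}$ with $V_i\Gamma_A=\Gamma_At_i$ for all $i$, and $\Gamma_\omega:\tilde{\mathcal{P}}\to\mathbb{C}\oplus(\Gamma(\mathbb{C}^d)\otimes\mathcal{D}_\omega)$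 with $\Gamma_\omega\Omega_{\tilde{\mathcal{P}}}=1\in\mathbb{C}$ and $\tilde V_i\Gamma_\omega=\Gamma_\omega s_i$ for all $i$. *)

theory Defs
  imports "HOL-Analysis.Analysis"
begin

section \<open>Complex Hilbert spaces\<close>

text \<open>The inner product is linear in the second argument.\<close>

class complex_hilbert = banach +
  fixes scaleC :: "complex \<Rightarrow> 'a \<Rightarrow> 'a" (infixr "*\<^sub>C" 75)
    and cinner :: "'a \<Rightarrow> 'a \<Rightarrow> complex"
  assumes scaleC_add_right: "a *\<^sub>C (x + y) = a *\<^sub>C x + a *\<^sub>C y"
    and scaleC_add_left: "(a + b) *\<^sub>C x = a *\<^sub>C x + b *\<^sub>C x"
    and scaleC_scaleC: "a *\<^sub>C b *\<^sub>C x = (a * b) *\<^sub>C x"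
    and scaleR_scaleC: "r *\<^sub>R x = complex_of_real r *\<^sub>C x"
    and cinner_commute: "cinner x y = cnj (cinner y x)"
    and cinner_add_right: "cinner x (y + z) = cinner x y + cinner x z"
    and cinner_scaleC_right: "cinner x (a *\<^sub>C y) = a * cinner x y"
    and cinner_self: "cinner x x = complex_of_real ((norm x)\<^sup>2)"

lemma scaleC_one: "1 *\<^sub>C x = (x :: 'a :: complex_hilbert)"
  by (metis of_real_1 scaleR_one scaleR_scaleC)

global_interpretation cvec: vector_space "scaleC :: complex \<Rightarrow> 'a \<Rightarrow> 'a :: complex_hilbert"
  defines cspan = cvec.span
  by unfold_locales (simp_all add: scaleC_add_right scaleC_add_left scaleC_scaleC scaleC_one)

lemma cinner_add_left: "cinner (x + y) z = cinner x z + cinner y (z :: 'a :: complex_hilbert)"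
  by (metis cinner_add_right cinner_commute complex_cnj_add)

lemma cinner_scaleC_left: "cinner (a *\<^sub>C x) z = cnj a * cinner x (z :: 'a :: complex_hilbert)"
  by (metis cinner_scaleC_right cinner_commute complex_cnj_mult)

lemma norm_scaleC: "norm (a *\<^sub>C x) = cmod a * norm (x :: 'a :: complex_hilbert)"
proof -
  have "complex_of_real ((norm (a *\<^sub>C x))\<^sup>2) = cinner (a *\<^sub>C x) (a *\<^sub>C x)"
    by (simp add: cinner_self)
  also have "\<dots> = cnj a * a * cinner x x"
    by (simp add: cinner_scaleC_left cinner_scaleC_right)
  also have "\<dots> = complex_of_real ((cmod a * norm x)\<^sup>2)"
    by (simp add: cinner_self power_mult_distrib complex_norm_square mult.commute flip: of_real_power)
  finally have "(norm (a *\<^sub>C x))\<^sup>2 = (cmod a * norm x)\<^sup>2"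
    using of_real_eq_iff by blast
  then show ?thesis by simp
qed

lemma complex_Cauchy_Schwarz: "cmod (cinner x y) \<le> norm x * norm (y :: 'a :: complex_hilbert)"
proof (cases "x = 0")
  case True
  have "cinner 0 y = 0" by (metis add_cancel_right_right cinner_add_left add_0)
  then show ?thesis using True by simp
next
  case False
  define c where "c = cinner x y"
  define n where "n = (norm x)\<^sup>2"
  have n: "n > 0" using False by (simp add: n_def)
  define z where "z = of_real n *\<^sub>C y + (- c) *\<^sub>C x"
  have cyx: "cinner y x = cnj c" by (metis c_def cinner_commute)
  have nn: "cinner x x = of_real n" "cinner y y = of_real ((norm y)\<^sup>2)"
    by (simp_all add: cinner_self n_def)
  have "cinner z z = of_real n * (of_real n * of_real ((norm y)\<^sup>2)) - of_real n * (c * cnj c)"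
    unfolding z_def cinner_add_left cinner_add_right cinner_scaleC_left cinner_scaleC_right cyx nn
      c_def[symmetric] by (simp add: algebra_simps)
  then have "complex_of_real ((norm z)\<^sup>2) = of_real (n * (n * (norm y)\<^sup>2 - (cmod c)\<^sup>2))"
    by (simp add: cinner_self complex_norm_square[symmetric] algebra_simps)
  then have "(norm z)\<^sup>2 = n * (n * (norm y)\<^sup>2 - (cmod c)\<^sup>2)"
    using of_real_eq_iff by blast
  then have "0 \<le> n * (n * (norm y)\<^sup>2 - (cmod c)\<^sup>2)" by (metis zero_le_power2)
  then have "(cmod c)\<^sup>2 \<le> n * (norm y)\<^sup>2"
    using n by (simp add: zero_le_mult_iff)
  then have "(cmod c)\<^sup>2 \<le> (norm x * norm y)\<^sup>2" by (simp add: n_def power_mult_distrib)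
  then show ?thesis unfolding c_def by (rule power2_le_imp_le) simp
qed

instantiation complex :: complex_hilbert
begin
definition scaleC_complex :: "complex \<Rightarrow> complex \<Rightarrow> complex" where
  "scaleC_complex a x = a * x"
definition cinner_complex :: "complex \<Rightarrow> complex \<Rightarrow> complex" where
  "cinner_complex x y = cnj x * y"
instance
  by standard (simp_all add: scaleC_complex_def cinner_complex_def algebra_simps
      scaleR_conv_of_real complex_norm_square flip: of_real_power)
end

instantiation prod :: (complex_hilbert, complex_hilbert) complex_hilbert
begin
definition scaleC_prod :: "complex \<Rightarrow> 'a \<times> 'b \<Rightarrow> 'a \<times> 'b" where
  "scaleC_prod a x = (a *\<^sub>C fst x, a *\<^sub>C snd x)"
definition cinner_prod :: "'a \<times> 'b \<Rightarrow> 'a \<times> 'b \<Rightarrow> complex" where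
  "cinner_prod x y = cinner (fst x) (fst y) + cinner (snd x) (snd y)"
instance
proof
  fix x y :: "'a \<times> 'b"
  show "cinner x y = cnj (cinner y x)"
    by (simp add: cinner_prod_def cinner_commute[symmetric])
  show "cinner x x = complex_of_real ((norm x)\<^sup>2)"
    by (simp add: cinner_prod_def cinner_self norm_prod_def flip: of_real_power of_real_add)
qed (simp_all add: scaleC_prod_def cinner_prod_def scaleC_add_right scaleC_add_left scaleC_scaleC
      scaleR_prod_def scaleR_scaleC cinner_add_right cinner_scaleC_right algebra_simps)
end

subsection \<open>Square-summable families\<close>

typedef (overloaded) ('i, 'a :: complex_hilbert) l2 =
  "{f :: 'i \<Rightarrow> 'a. (\<lambda>i. (norm (f i))\<^sup>2) summable_on UNIV}"
  morphisms l2_nth Abs_l2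
  by (rule exI[of _ "\<lambda>_. 0"]) simp

setup_lifting type_definition_l2

lemma l2_summable: "(\<lambda>i. (norm (l2_nth x i))\<^sup>2) summable_on UNIV"
  using l2_nth by blast

lemma l2_eqI: "(\<And>i. l2_nth x i = l2_nth y i) \<Longrightarrow> x = y"
  by (metis ext l2_nth_inject)

lemma l2_add_bound: "(norm (x + y))\<^sup>2 \<le> 2 * (norm x)\<^sup>2 + 2 * (norm (y :: 'a :: real_normed_vector))\<^sup>2"
proof -
  have "(norm (x + y))\<^sup>2 \<le> (norm x + norm y)\<^sup>2"
    by (rule power_mono) (auto intro: norm_triangle_ineq)
  also have "\<dots> \<le> 2 * (norm x)\<^sup>2 + 2 * (norm y)\<^sup>2"
    using zero_le_power2[of "norm x - norm y"] by (simp add: power2_eq_square algebra_simps)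
  finally show ?thesis .
qed

lemma l2_add_summable:
  fixes f g :: "'i \<Rightarrow> 'a :: real_normed_vector"
  assumes "(\<lambda>i. (norm (f i))\<^sup>2) summable_on UNIV" "(\<lambda>i. (norm (g i))\<^sup>2) summable_on UNIV"
  shows "(\<lambda>i. (norm (f i + g i))\<^sup>2) summable_on UNIV"
proof (rule summable_on_comparison_test)
  show "(\<lambda>i. 2 * (norm (f i))\<^sup>2 + 2 * (norm (g i))\<^sup>2) summable_on UNIV"
    using assms by (intro summable_on_add summable_on_cmult_right)
qed (auto intro: l2_add_bound)

instantiation l2 :: (type, complex_hilbert) real_normed_vector
begin

lift_definition zero_l2 :: "('a, 'b) l2" is "\<lambda>_. 0" by simp
lift_definition plus_l2 :: "('a, 'b) l2 \<Rightarrow> ('a, 'b) l2 \<Rightarrow> ('a, 'b) l2" is "\<lambda>f g i. f i + g i"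
  by (rule l2_add_summable)
lift_definition uminus_l2 :: "('a, 'b) l2 \<Rightarrow> ('a, 'b) l2" is "\<lambda>f i. - f i" by simp
lift_definition minus_l2 :: "('a, 'b) l2 \<Rightarrow> ('a, 'b) l2 \<Rightarrow> ('a, 'b) l2" is "\<lambda>f g i. f i - g i"
  subgoal for f g using l2_add_summable[of f "\<lambda>i. - g i"] by simp
  done
lift_definition scaleR_l2 :: "real \<Rightarrow> ('a, 'b) l2 \<Rightarrow> ('a, 'b) l2" is "\<lambda>a f i. a *\<^sub>R f i"
  by (simp add: power_mult_distrib summable_on_cmult_right)
definition norm_l2 :: "('a, 'b) l2 \<Rightarrow> real" where
  "norm_l2 x = sqrt (\<Sum>\<^sub>\<infinity>i. (norm (l2_nth x i))\<^sup>2)"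
definition dist_l2 :: "('a, 'b) l2 \<Rightarrow> ('a, 'b) l2 \<Rightarrow> real" where
  "dist_l2 x y = norm (x - y)"
definition sgn_l2 :: "('a, 'b) l2 \<Rightarrow> ('a, 'b) l2" where
  "sgn_l2 x = inverse (norm x) *\<^sub>R x"
definition uniformity_l2 :: "(('a, 'b) l2 \<times> ('a, 'b) l2) filter" where
  "uniformity_l2 = (INF e\<in>{0<..}. principal {(x, y). dist x y < e})"
definition open_l2 :: "('a, 'b) l2 set \<Rightarrow> bool" where
  "open_l2 U = (\<forall>x\<in>U. eventually (\<lambda>(x', y). x' = x \<longrightarrow> y \<in> U) uniformity)"

lemmas l2_nth_simps = zero_l2.rep_eq plus_l2.rep_eq uminus_l2.rep_eq minus_l2.rep_eq scaleR_l2.rep_eq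

lemma norm_l2_power2: "(norm x)\<^sup>2 = (\<Sum>\<^sub>\<infinity>i. (norm (l2_nth x i))\<^sup>2)" for x :: "('a, 'b) l2"
  by (simp add: norm_l2_def infsum_nonneg)

lemma norm_l2_ge_0: "0 \<le> norm x" for x :: "('a, 'b) l2"
  by (simp add: norm_l2_def infsum_nonneg)

lemma L2_set_le_norm_l2:
  fixes x :: "('a, 'b) l2"
  assumes "finite F"
  shows "L2_set (\<lambda>i. norm (l2_nth x i)) F \<le> norm x"
  unfolding L2_set_def norm_l2_def
  by (rule real_sqrt_le_mono, rule finite_sum_le_infsum) (auto simp: l2_summable assms)

lemma norm_l2_leI:
  fixes x :: "('a, 'b) l2"
  assumes "B \<ge> 0" "\<And>F. finite F \<Longrightarrow> L2_set (\<lambda>i. norm (l2_nth x i)) F \<le> B"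
  shows "norm x \<le> B"
proof -
  have "(\<Sum>\<^sub>\<infinity>i. (norm (l2_nth x i))\<^sup>2) \<le> B\<^sup>2"
  proof (rule infsum_le_finite_sums)
    fix F :: "'a set" assume "finite F"
    from assms(2)[OF this] show "(\<Sum>i\<in>F. (norm (l2_nth x i))\<^sup>2) \<le> B\<^sup>2"
      unfolding L2_set_def using sqrt_le_D by blast
  qed (rule l2_summable)
  then show ?thesis unfolding norm_l2_def using assms(1) real_sqrt_le_iff[of _ "B\<^sup>2"]
    by (metis real_sqrt_abs abs_of_nonneg)
qed

lemma norm_l2_nth_le: "norm (l2_nth x i) \<le> norm x" for x :: "('a, 'b) l2"
  using L2_set_le_norm_l2[of "{i}" x] by (simp add: L2_set_def)

instance
proof
  fix x y z :: "('a, 'b) l2" and r s :: real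
  show "x + y + z = x + (y + z)" "x + y = y + x" "0 + x = x" "- x + x = 0" "x - y = x + - y"
    by (auto intro!: l2_eqI simp: l2_nth_simps)
  show "r *\<^sub>R (x + y) = r *\<^sub>R x + r *\<^sub>R y" "(r + s) *\<^sub>R x = r *\<^sub>R x + s *\<^sub>R x"
    "r *\<^sub>R s *\<^sub>R x = (r * s) *\<^sub>R x" "1 *\<^sub>R x = x"
    by (auto intro!: l2_eqI simp: l2_nth_simps algebra_simps)
  show "dist x y = norm (x - y)" "sgn x = inverse (norm x) *\<^sub>R x" by (fact dist_l2_def sgn_l2_def)+
  show "uniformity = (INF e\<in>{0<..}. principal {(x :: ('a, 'b) l2, y). dist x y < e})"
    by (fact uniformity_l2_def)
  show "open U = (\<forall>x\<in>U. \<forall>\<^sub>F (x', y) in uniformity. x' = x \<longrightarrow> y \<in> U)" for U :: "('a, 'b) l2 set"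
    by (fact open_l2_def)
  show "norm x = 0 \<longleftrightarrow> x = 0"
  proof
    assume "norm x = 0"
    then have "l2_nth x i = 0" for i using norm_l2_nth_le[of x i] by simp
    then show "x = 0" by (auto intro!: l2_eqI simp: l2_nth_simps)
  qed (simp add: norm_l2_def l2_nth_simps)
  show "norm (x + y) \<le> norm x + norm y"
  proof (rule norm_l2_leI)
    fix F :: "'a set" assume F: "finite F"
    have "L2_set (\<lambda>i. norm (l2_nth (x + y) i)) F
        \<le> L2_set (\<lambda>i. norm (l2_nth x i) + norm (l2_nth y i)) F"
      by (rule L2_set_mono) (auto simp: l2_nth_simps intro: norm_triangle_ineq)
    also have "\<dots> \<le> L2_set (\<lambda>i. norm (l2_nth x i)) F + L2_set (\<lambda>i. norm (l2_nth y i)) F"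
      by (rule L2_set_triangle_ineq)
    also have "\<dots> \<le> norm x + norm y" using L2_set_le_norm_l2[OF F] by (intro add_mono)
    finally show "L2_set (\<lambda>i. norm (l2_nth (x + y) i)) F \<le> norm x + norm y" .
  qed (simp add: norm_l2_ge_0)
  have "(norm (r *\<^sub>R x))\<^sup>2 = (\<bar>r\<bar> * norm x)\<^sup>2"
    by (simp add: norm_l2_power2 l2_nth_simps power_mult_distrib infsum_cmult_right l2_summable)
  then show "norm (r *\<^sub>R x) = \<bar>r\<bar> * norm x" by (simp add: norm_l2_ge_0)
qed
end

instance l2 :: (type, complex_hilbert) banach
proof
  fix X :: "nat \<Rightarrow> ('a, 'b) l2"
  assume "Cauchy X"
  then have C: "\<exists>N. \<forall>m\<ge>N. \<forall>n\<ge>N. norm (X m - X n) < e" if "e > 0" for e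
    using that unfolding Cauchy_def dist_norm by blast
  have "Cauchy (\<lambda>n. l2_nth (X n) i)" for i
    unfolding Cauchy_def dist_norm
  proof (intro allI impI)
    fix e :: real assume "e > 0"
    from C[OF this] show "\<exists>M. \<forall>m\<ge>M. \<forall>n\<ge>M. norm (l2_nth (X m) i - l2_nth (X n) i) < e"
      using norm_l2_nth_le[of "X _ - X _" i] by (metis le_less_trans minus_l2.rep_eq)
  qed
  then have "\<forall>i. \<exists>l. (\<lambda>n. l2_nth (X n) i) \<longlonglongrightarrow> l"
    using Cauchy_convergent_iff convergent_def by blast
  then obtain f where f: "\<And>i. (\<lambda>n. l2_nth (X n) i) \<longlonglongrightarrow> f i" by metis
  have key: "\<exists>N. \<forall>n\<ge>N. \<forall>F. finite F \<longrightarrow> (\<Sum>i\<in>F. (norm (l2_nth (X n) i - f i))\<^sup>2) \<le> e\<^sup>2"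
    if e: "e > 0" for e
  proof -
    from C[OF e] obtain N where N: "\<And>m n. m \<ge> N \<Longrightarrow> n \<ge> N \<Longrightarrow> norm (X n - X m) < e" by blast
    show ?thesis
    proof (intro exI[of _ N] allI impI)
      fix n F assume n: "n \<ge> N" and F: "finite (F :: 'a set)"
      show "(\<Sum>i\<in>F. (norm (l2_nth (X n) i - f i))\<^sup>2) \<le> e\<^sup>2"
      proof (rule tendsto_upperbound)
        show "(\<lambda>m. \<Sum>i\<in>F. (norm (l2_nth (X n) i - l2_nth (X m) i))\<^sup>2)
            \<longlonglongrightarrow> (\<Sum>i\<in>F. (norm (l2_nth (X n) i - f i))\<^sup>2)"
          by (intro tendsto_intros f)
        show "\<forall>\<^sub>F m in sequentially. (\<Sum>i\<in>F. (norm (l2_nth (X n) i - l2_nth (X m) i))\<^sup>2) \<le> e\<^sup>2"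
          using eventually_ge_at_top[of N]
        proof eventually_elim
          case (elim m)
          have "L2_set (\<lambda>i. norm (l2_nth (X n - X m) i)) F \<le> e"
            using L2_set_le_norm_l2[OF F, of "X n - X m"] N[OF elim n] by linarith
          then show ?case unfolding L2_set_def minus_l2.rep_eq using sqrt_le_D by blast
        qed
      qed simp
    qed
  qed
  have diff: "(\<lambda>i. (norm (l2_nth (X n) i - f i))\<^sup>2) summable_on UNIV"
    if "\<forall>F. finite F \<longrightarrow> (\<Sum>i\<in>F. (norm (l2_nth (X n) i - f i))\<^sup>2) \<le> e\<^sup>2" for n e
    by (rule nonneg_bdd_above_summable_on) (use that in \<open>auto intro!: bdd_aboveI2[of _ _ "e\<^sup>2"]\<close>)
  from key[of 1] obtain n0 where
    "\<forall>F. finite F \<longrightarrow> (\<Sum>i\<in>F. (norm (l2_nth (X n0) i - f i))\<^sup>2) \<le> 1\<^sup>2" by fastforce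
  from diff[OF this] have "(\<lambda>i. (norm (f i - l2_nth (X n0) i))\<^sup>2) summable_on UNIV"
    by (simp add: norm_minus_commute)
  from l2_add_summable[OF this l2_summable[of "X n0"]]
  have "(\<lambda>i. (norm (f i))\<^sup>2) summable_on UNIV" by simp
  then have Lf: "l2_nth (Abs_l2 f) = f" by (simp add: Abs_l2_inverse)
  have le: "\<exists>N. \<forall>n\<ge>N. norm (X n - Abs_l2 f) \<le> e" if e: "e > 0" for e
  proof -
    from key[OF e] obtain N where
      N: "\<And>n F. n \<ge> N \<Longrightarrow> finite F \<Longrightarrow> (\<Sum>i\<in>F. (norm (l2_nth (X n) i - f i))\<^sup>2) \<le> e\<^sup>2" by blast
    have "norm (X n - Abs_l2 f) \<le> e" if "n \<ge> N" for n
    proof -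
      have "(\<Sum>\<^sub>\<infinity>i. (norm (l2_nth (X n - Abs_l2 f) i))\<^sup>2) \<le> e\<^sup>2"
        by (rule infsum_le_finite_sums[OF l2_summable])
          (use N[OF that] in \<open>auto simp: minus_l2.rep_eq Lf\<close>)
      then show ?thesis unfolding norm_l2_def using e by (metis real_le_lsqrt order_less_imp_le
            infsum_nonneg zero_le_power2 real_sqrt_le_mono real_sqrt_abs abs_of_pos)
    qed
    then show ?thesis by blast
  qed
  have "X \<longlonglongrightarrow> Abs_l2 f"
    unfolding lim_sequentially dist_norm
  proof (intro allI impI)
    fix e :: real assume "e > 0"
    with le[of "e/2"] obtain N where "\<And>n. n \<ge> N \<Longrightarrow> norm (X n - Abs_l2 f) \<le> e/2" by auto
    with \<open>e > 0\<close> show "\<exists>N. \<forall>n\<ge>N. norm (X n - Abs_l2 f) < e"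
      by (intro exI[of _ N]) (force dest: order.strict_trans1)
  qed
  then show "convergent X" by (auto simp: convergent_def)
qed

instantiation l2 :: (type, complex_hilbert) complex_hilbert
begin

lift_definition scaleC_l2 :: "complex \<Rightarrow> ('a, 'b) l2 \<Rightarrow> ('a, 'b) l2" is "\<lambda>a f i. a *\<^sub>C f i"
  by (simp add: norm_scaleC power_mult_distrib summable_on_cmult_right)
definition cinner_l2 :: "('a, 'b) l2 \<Rightarrow> ('a, 'b) l2 \<Rightarrow> complex" where
  "cinner_l2 x y = (\<Sum>\<^sub>\<infinity>i. cinner (l2_nth x i) (l2_nth y i))"

instance
proof
  have summ: "(\<lambda>i. cinner (l2_nth x i) (l2_nth y i)) summable_on UNIV" for x y :: "('a, 'b) l2"
  proof (rule Infinite_Sum.abs_summable_summable, rule Infinite_Sum.abs_summable_on_comparison_test')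
    show "(\<lambda>i. (norm (l2_nth x i))\<^sup>2 + (norm (l2_nth y i))\<^sup>2) summable_on UNIV"
      by (intro summable_on_add l2_summable)
  next
    fix i :: 'a
    have "cmod (cinner (l2_nth x i) (l2_nth y i)) \<le> norm (l2_nth x i) * norm (l2_nth y i)"
      by (rule complex_Cauchy_Schwarz)
    also have "\<dots> \<le> (norm (l2_nth x i))\<^sup>2 + (norm (l2_nth y i))\<^sup>2"
      using sum_squares_bound[of "norm (l2_nth x i)" "norm (l2_nth y i)"]
        mult_nonneg_nonneg[OF norm_ge_zero[of "l2_nth x i"] norm_ge_zero[of "l2_nth y i"]] by linarith
    finally show "cmod (cinner (l2_nth x i) (l2_nth y i)) \<le> (norm (l2_nth x i))\<^sup>2 + (norm (l2_nth y i))\<^sup>2" .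
  qed
  fix x y z :: "('a, 'b) l2" and a b :: complex and r :: real
  show "a *\<^sub>C (x + y) = a *\<^sub>C x + a *\<^sub>C y" "(a + b) *\<^sub>C x = a *\<^sub>C x + b *\<^sub>C x"
    "a *\<^sub>C b *\<^sub>C x = (a * b) *\<^sub>C x" "r *\<^sub>R x = complex_of_real r *\<^sub>C x"
    by (auto intro!: l2_eqI simp: l2_nth_simps scaleC_l2.rep_eq scaleC_add_right scaleC_add_left scaleC_scaleC scaleR_scaleC)
  show "cinner x y = cnj (cinner y x)"
    unfolding cinner_l2_def by (simp flip: infsum_cnj add: cinner_commute[symmetric])
  show "cinner x (y + z) = cinner x y + cinner x z"
    by (simp add: cinner_l2_def l2_nth_simps scaleC_l2.rep_eq cinner_add_right infsum_add summ)
  show "cinner x (a *\<^sub>C y) = a * cinner x y"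
    by (simp add: cinner_l2_def l2_nth_simps scaleC_l2.rep_eq cinner_scaleC_right infsum_cmult_right summ)
  have "((\<lambda>i. complex_of_real ((norm (l2_nth x i))\<^sup>2)) has_sum complex_of_real ((norm x)\<^sup>2)) UNIV"
    unfolding norm_l2_power2 has_sum_of_real_iff by (rule has_sum_infsum[OF l2_summable])
  then show "cinner x x = complex_of_real ((norm x)\<^sup>2)"
    unfolding cinner_l2_def cinner_self by (rule infsumI)
qed
end

lift_definition l2_single :: "'i \<Rightarrow> 'a :: complex_hilbert \<Rightarrow> ('i, 'a) l2" is
  "\<lambda>i x j. if j = i then x else 0"
  subgoal for i x
    by (rule finite_nonzero_values_imp_summable_on) (auto intro: finite_subset[of _ "{i}"])
  done

section \<open>Operators\<close>

definition bounded_clinear :: "('a :: complex_hilbert \<Rightarrow> 'b :: complex_hilbert) \<Rightarrow> bool" where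
  "bounded_clinear T \<longleftrightarrow> bounded_linear T \<and> (\<forall>c x. T (c *\<^sub>C x) = c *\<^sub>C T x)"

definition hadj :: "('a :: complex_hilbert \<Rightarrow> 'b :: complex_hilbert) \<Rightarrow> 'b \<Rightarrow> 'a" where
  "hadj T = (THE S. bounded_clinear S \<and> (\<forall>y x. cinner (S y) x = cinner y (T x)))"

definition pos_sqrt :: "('a :: complex_hilbert \<Rightarrow> 'a) \<Rightarrow> 'a \<Rightarrow> 'a" where
  "pos_sqrt T = (THE S. bounded_clinear S \<and> (\<forall>x. cinner x (S x) \<in> \<real> \<and> 0 \<le> Re (cinner x (S x)))
     \<and> (\<forall>x. S (S x) = T x))"

text \<open>Operators between closed subspaces are represented by functions on the ambient spaces, whose
  values outside the domain are irrelevant.\<close>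

definition isometry_on :: "('a :: complex_hilbert \<Rightarrow> 'b :: complex_hilbert) \<Rightarrow> 'a set \<Rightarrow> 'b set \<Rightarrow> bool" where
  "isometry_on T X Y \<longleftrightarrow> (\<forall>x\<in>X. \<forall>y\<in>X. T (x + y) = T x + T y) \<and> (\<forall>c. \<forall>x\<in>X. T (c *\<^sub>C x) = c *\<^sub>C T x)
     \<and> (\<forall>x\<in>X. norm (T x) = norm x) \<and> T ` X \<subseteq> Y"

definition unitary_on :: "('a :: complex_hilbert \<Rightarrow> 'b :: complex_hilbert) \<Rightarrow> 'a set \<Rightarrow> 'b set \<Rightarrow> bool" where
  "unitary_on T X Y \<longleftrightarrow> isometry_on T X Y \<and> T ` X = Y"

section \<open>Row contractions\<close>

text \<open>A tuple indexed by \<open>1, \<dots>, d\<close> with \<open>d \<in> {2, 3, \<dots>} \<union> {\<infinity>}\<close> is a family over a countable type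
  \<open>'i\<close> that does not have exactly one element; \<open>('i, complex) l2\<close> is \<open>\<complex>\<^sup>d\<close> and \<open>('i, 'h) l2\<close> is
  the direct sum of \<open>d\<close> copies of the space \<open>'h\<close>.\<close>

definition row :: "('i \<Rightarrow> 'h :: complex_hilbert \<Rightarrow> 'h) \<Rightarrow> ('i, 'h) l2 \<Rightarrow> 'h" where
  "row A x = (\<Sum>\<^sub>\<infinity>i. A i (l2_nth x i))"

definition row_contraction :: "('i \<Rightarrow> 'h :: complex_hilbert \<Rightarrow> 'h) \<Rightarrow> bool" where
  "row_contraction A \<longleftrightarrow> (\<forall>i. bounded_clinear (A i)) \<and>
     (\<forall>x. (\<lambda>i. A i (l2_nth x i)) summable_on UNIV \<and> norm (row A x) \<le> norm x)"

definition coisometric :: "('i \<Rightarrow> 'h :: complex_hilbert \<Rightarrow> 'h) \<Rightarrow> bool" where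
  "coisometric A \<longleftrightarrow> (\<forall>h. ((\<lambda>i. A i (hadj (A i) h)) has_sum h) UNIV)"

definition ergodic :: "('i \<Rightarrow> 'h :: complex_hilbert \<Rightarrow> 'h) \<Rightarrow> bool" where
  "ergodic A \<longleftrightarrow> (\<forall>x. bounded_clinear x \<and> (\<forall>h. ((\<lambda>i. A i (x (hadj (A i) h))) has_sum x h) UNIV)
     \<longrightarrow> (\<exists>c. \<forall>h. x h = c *\<^sub>C h))"

definition defect :: "('i \<Rightarrow> 'h :: complex_hilbert \<Rightarrow> 'h) \<Rightarrow> ('i, 'h) l2 \<Rightarrow> ('i, 'h) l2" where
  "defect A = pos_sqrt (\<lambda>x. x - hadj (row A) (row A x))"

definition defect_space :: "('i \<Rightarrow> 'h :: complex_hilbert \<Rightarrow> 'h) \<Rightarrow> ('i, 'h) l2 set" where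
  "defect_space A = range (defect A)"

definition orthonormal_basis :: "('i \<Rightarrow> 'p :: complex_hilbert) \<Rightarrow> bool" where
  "orthonormal_basis e \<longleftrightarrow> (\<forall>i j. cinner (e i) (e j) = (if i = j then 1 else 0))
     \<and> closure (cspan (range e)) = UNIV"

section \<open>Tensor products\<close>

text \<open>A tensor product is a Hilbert space together with a total family of elementary tensors that have
  the prescribed inner products. This determines it up to a unique unitary compatible with the
  elementary tensors; multilinearity of the elementary tensors follows from the inner products.\<close>

definition hilbert_tensor ::
  "('a :: complex_hilbert \<Rightarrow> 'b :: complex_hilbert \<Rightarrow> 'c :: complex_hilbert) \<Rightarrow> bool" where
  "hilbert_tensor T \<longleftrightarrow> (\<forall>a b a' b'. cinner (T a b) (T a' b') = cinner a a' * cinner b b')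
     \<and> closure (cspan {T a b |a b. True}) = UNIV"

text \<open>The infinite tensor product of copies of one space along a unit vector \<open>\<Omega>\<close>: elementary tensors
  are indexed by the sequences that are eventually equal to \<open>\<Omega>\<close>.\<close>

definition tail_seqs :: "'k \<Rightarrow> (nat \<Rightarrow> 'k) set" where
  "tail_seqs \<Omega> = {f. \<exists>N. \<forall>n\<ge>N. f n = \<Omega>}"

definition infinite_tensor ::
  "'k :: complex_hilbert \<Rightarrow> ((nat \<Rightarrow> 'k) \<Rightarrow> 'kk :: complex_hilbert) \<Rightarrow> bool" where
  "infinite_tensor \<Omega> T \<longleftrightarrow>
     (\<forall>f g N. (\<forall>n\<ge>N. f n = \<Omega> \<and> g n = \<Omega>) \<longrightarrow> cinner (T f) (T g) = (\<Prod>n<N. cinner (f n) (g n)))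
     \<and> closure (cspan (T ` tail_seqs \<Omega>)) = UNIV"

text \<open>\<open>list_cinner\<close> is the inner product of elementary tensors in the orthogonal sum of all finite
  tensor powers, \<open>full_fock F\<close> says that \<open>F [x\<^sub>1, \<dots>, x\<^sub>n]\<close> is the elementary tensor
  \<open>x\<^sub>1 \<otimes> \<dots> \<otimes> x\<^sub>n\<close> in the full Fock space, with vacuum \<open>F []\<close>. In \<open>mixed_tensor M\<close> the elements
  \<open>M h [p\<^sub>1, \<dots>, p\<^sub>j] [k\<^sub>1, \<dots>, k\<^sub>l]\<close> are the elementary tensors of the mutually orthogonal subspaces
  \<open>\<H> \<otimes> \<P> \<otimes> \<dots> \<otimes> \<P> \<otimes> \<K> \<otimes> \<dots> \<otimes> \<K>\<close> (\<open>j\<close> factors \<open>\<P>\<close>, then \<open>l\<close> factors \<open>\<K>\<close>) of one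
  Hilbert space, for all \<open>j\<close> and \<open>l\<close>.\<close>

definition list_cinner :: "'a :: complex_hilbert list \<Rightarrow> 'a list \<Rightarrow> complex" where
  "list_cinner xs ys = (if length xs = length ys then \<Prod>n<length xs. cinner (xs ! n) (ys ! n) else 0)"

definition full_fock :: "('a :: complex_hilbert list \<Rightarrow> 'g :: complex_hilbert) \<Rightarrow> bool" where
  "full_fock F \<longleftrightarrow> (\<forall>xs ys. cinner (F xs) (F ys) = list_cinner xs ys)
     \<and> closure (cspan (range F)) = UNIV"

definition mixed_tensor ::
  "('h :: complex_hilbert \<Rightarrow> 'p :: complex_hilbert list \<Rightarrow> 'k :: complex_hilbert list
    \<Rightarrow> 'f :: complex_hilbert) \<Rightarrow> bool" where
  "mixed_tensor M \<longleftrightarrow>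
     (\<forall>h ps ks h' ps' ks'. cinner (M h ps ks) (M h' ps' ks')
        = cinner h h' * list_cinner ps ps' * list_cinner ks ks')
     \<and> closure (cspan {M h ps ks |h ps ks. True}) = UNIV"

text \<open>Below, a bounded operator is given by its values on elementary tensors, which determine it.\<close>

definition tensor_Cons ::
  "'k \<Rightarrow> ((nat \<Rightarrow> 'k) \<Rightarrow> 'kk) \<Rightarrow> 'k :: complex_hilbert \<Rightarrow> 'kk :: complex_hilbert \<Rightarrow> 'kk" where
  \<comment> \<open>\<open>k \<otimes> y\<close> under the identification of \<open>\<K> \<otimes> \<K>\<^sup>\<infinity>\<close> with \<open>\<K>\<^sup>\<infinity>\<close>\<close>
  "tensor_Cons \<Omega> T k =
     (THE S. bounded_clinear S \<and> (\<forall>f\<in>tail_seqs \<Omega>. S (T f) = T (case_nat k f)))"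

definition tensor_assoc ::
  "('h \<Rightarrow> 'k :: complex_hilbert \<Rightarrow> 'hk) \<Rightarrow> ('h \<Rightarrow> 'kk \<Rightarrow> 'hkk) \<Rightarrow> 'k \<Rightarrow> ((nat \<Rightarrow> 'k) \<Rightarrow> 'kk) \<Rightarrow>
   'hk :: complex_hilbert \<Rightarrow> 'kk :: complex_hilbert \<Rightarrow> 'hkk :: complex_hilbert" where
  \<comment> \<open>\<open>z \<otimes> y\<close> under the identification of \<open>(\<H> \<otimes> \<K>) \<otimes> \<K>\<^sup>\<infinity>\<close> with \<open>\<H> \<otimes> \<K>\<^sup>\<infinity>\<close>\<close>
  "tensor_assoc HK HKK \<Omega> T z y =
     (THE S. bounded_clinear S \<and>
        (\<forall>h k. S (HK h k) = HKK h (tensor_Cons \<Omega> T k y))) z"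

definition tensor_pad :: "'k \<Rightarrow> ((nat \<Rightarrow> 'k) \<Rightarrow> 'kk) \<Rightarrow> 'k list \<Rightarrow> 'kk" where
  \<comment> \<open>\<open>k\<^sub>1 \<otimes> \<dots> \<otimes> k\<^sub>n \<otimes> \<Omega> \<otimes> \<Omega> \<otimes> \<dots>\<close>\<close>
  "tensor_pad \<Omega> T ks = T (\<lambda>n. if n < length ks then ks ! n else \<Omega>)"

section \<open>The tensor product dilation\<close>

definition dilation_t ::
  "('h \<Rightarrow> 'p \<Rightarrow> 'hp) \<Rightarrow> ('h \<Rightarrow> 'k :: complex_hilbert \<Rightarrow> 'hk) \<Rightarrow> ('h \<Rightarrow> 'kk :: complex_hilbert \<Rightarrow> 'hkk) \<Rightarrow> 'k \<Rightarrow>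
   ((nat \<Rightarrow> 'k) \<Rightarrow> 'kk) \<Rightarrow> ('i \<Rightarrow> 'p) \<Rightarrow> ('hp \<Rightarrow> 'hk :: complex_hilbert) \<Rightarrow> 'i \<Rightarrow>
   'hkk :: complex_hilbert \<Rightarrow> 'hkk" where
  "dilation_t HP HK HKK \<Omega>K T \<epsilon> u i =
     (THE S. bounded_clinear S \<and>
        (\<forall>h y. S (HKK h y) = tensor_assoc HK HKK \<Omega>K T (u (HP h (\<epsilon> i))) y))"

definition dilation_space ::
  "('i \<Rightarrow> 'x \<Rightarrow> 'x) \<Rightarrow> ('h \<Rightarrow> 'x) \<Rightarrow> 'x :: complex_hilbert set" where
  \<comment> \<open>closed linear span of the vectors \<open>t\<^sub>\<alpha> (\<iota> h)\<close> for words \<open>\<alpha>\<close>, where \<open>\<iota>\<close> embeds \<open>\<H>\<close>\<close>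
  "dilation_space t \<iota> = closure (cspan {foldr t \<alpha> (\<iota> h) |\<alpha> h. True})"

section \<open>The infinite product formula\<close>

definition finite_power ::
  "('h \<Rightarrow> 'p list \<Rightarrow> 'k list \<Rightarrow> 'f :: complex_hilbert) \<Rightarrow> nat \<Rightarrow> 'f set" where
  \<comment> \<open>\<open>\<H> \<otimes> \<K> \<otimes> \<dots> \<otimes> \<K>\<close> with \<open>m\<close> factors \<open>\<K>\<close>\<close>
  "finite_power M m = closure (cspan {M h [] ks |h ks. length ks = m})"

definition insert_HK ::
  "('h \<Rightarrow> 'k \<Rightarrow> 'hk) \<Rightarrow> ('h \<Rightarrow> 'p list \<Rightarrow> 'k list \<Rightarrow> 'f) \<Rightarrow> 'p list \<Rightarrow> 'k list \<Rightarrow>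
   'hk :: complex_hilbert \<Rightarrow> 'f :: complex_hilbert" where
  "insert_HK HK M ps ks = (THE S. bounded_clinear S \<and> (\<forall>h k. S (HK h k) = M h ps (k # ks)))"

text \<open>\<open>u_slot n\<close> is \<open>u\<close> acting on \<open>\<H>\<close> and the \<open>n\<close>-th tensor factor (\<open>n \<ge> 1\<close>), from
  \<open>\<H> \<otimes> \<P> \<otimes> \<dots> \<otimes> \<P> \<otimes> \<K> \<otimes> \<dots> \<otimes> \<K>\<close> with \<open>n\<close> factors \<open>\<P>\<close> to the space with \<open>n - 1\<close>
  factors \<open>\<P>\<close> and one more factor \<open>\<K>\<close>. It is extended by zero to the other summands of the ambient
  space, and so is its adjoint.\<close>

definition u_slot ::
  "('h \<Rightarrow> 'p \<Rightarrow> 'hp) \<Rightarrow> ('h \<Rightarrow> 'k \<Rightarrow> 'hk) \<Rightarrow> ('h \<Rightarrow> 'p list \<Rightarrow> 'k list \<Rightarrow> 'f) \<Rightarrow>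
   ('hp \<Rightarrow> 'hk :: complex_hilbert) \<Rightarrow> nat \<Rightarrow> 'f :: complex_hilbert \<Rightarrow> 'f" where
  "u_slot HP HK M u n =
     (THE S. bounded_clinear S \<and>
        (\<forall>h ps p ks. length (ps @ [p]) = n \<longrightarrow>
           S (M h (ps @ [p]) ks) = insert_HK HK M ps ks (u (HP h p))) \<and>
        (\<forall>h ps ks. length ps \<noteq> n \<longrightarrow> S (M h ps ks) = 0))"

primrec u_adj_prod ::
  "('h \<Rightarrow> 'p \<Rightarrow> 'hp) \<Rightarrow> ('h \<Rightarrow> 'k \<Rightarrow> 'hk) \<Rightarrow> ('h \<Rightarrow> 'p list \<Rightarrow> 'k list \<Rightarrow> 'f) \<Rightarrow>
   ('hp \<Rightarrow> 'hk :: complex_hilbert) \<Rightarrow> nat \<Rightarrow> 'f :: complex_hilbert \<Rightarrow> 'f" where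
  "u_adj_prod HP HK M u 0 \<xi> = \<xi>"
| "u_adj_prod HP HK M u (Suc n) \<xi> = hadj (u_slot HP HK M u (Suc n)) (u_adj_prod HP HK M u n \<xi>)"

definition append_vac ::
  "('h \<Rightarrow> 'p list \<Rightarrow> 'k list \<Rightarrow> 'f) \<Rightarrow> 'k \<Rightarrow> nat \<Rightarrow> 'f :: complex_hilbert \<Rightarrow> 'f" where
  \<comment> \<open>\<open>\<xi> \<mapsto> \<xi> \<otimes> \<Omega> \<otimes> \<dots> \<otimes> \<Omega>\<close> with \<open>r\<close> factors \<open>\<Omega>\<close>\<close>
  "append_vac M \<Omega> r =
     (THE S. bounded_clinear S \<and> (\<forall>h ps ks. S (M h ps ks) = M h ps (ks @ replicate r \<Omega>)))"

definition embed_K ::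
  "('h \<Rightarrow> 'p list \<Rightarrow> 'k list \<Rightarrow> 'f) \<Rightarrow> ('h \<Rightarrow> 'kk \<Rightarrow> 'hkk) \<Rightarrow> 'k \<Rightarrow> ((nat \<Rightarrow> 'k) \<Rightarrow> 'kk) \<Rightarrow>
   nat \<Rightarrow> 'f :: complex_hilbert \<Rightarrow> 'hkk :: complex_hilbert" where
  \<comment> \<open>embedding of the \<open>m\<close>-factor space \<open>\<H> \<otimes> \<K> \<otimes> \<dots> \<otimes> \<K>\<close>, extended by zero\<close>
  "embed_K M HKK \<Omega> T m =
     (THE S. bounded_clinear S \<and> (\<forall>h ps ks. S (M h ps ks) =
        (if ps = [] \<and> length ks = m then HKK h (tensor_pad \<Omega> T ks) else 0)))"

definition embed_P ::
  "('h \<Rightarrow> 'p list \<Rightarrow> 'k list \<Rightarrow> 'f) \<Rightarrow> ('h \<Rightarrow> 'pp \<Rightarrow> 'hpp) \<Rightarrow> 'p \<Rightarrow> ((nat \<Rightarrow> 'p) \<Rightarrow> 'pp) \<Rightarrow>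
   nat \<Rightarrow> 'f :: complex_hilbert \<Rightarrow> 'hpp :: complex_hilbert" where
  "embed_P M HPP \<Omega> T n =
     (THE S. bounded_clinear S \<and> (\<forall>h ps ks. S (M h ps ks) =
        (if ks = [] \<and> length ps = n then HPP h (tensor_pad \<Omega> T ps) else 0)))"

section \<open>The Fock space dilation\<close>

definition creation ::
  "(('i, complex) l2 list \<Rightarrow> 'g) \<Rightarrow> 'i \<Rightarrow> 'g :: complex_hilbert \<Rightarrow> 'g" where
  "creation F i = (THE S. bounded_clinear S \<and> (\<forall>xs. S (F xs) = F (l2_single i 1 # xs)))"

definition creation_id ::
  "(('i, complex) l2 list \<Rightarrow> 'g :: complex_hilbert) \<Rightarrow> ('g \<Rightarrow> 'v \<Rightarrow> 'gv) \<Rightarrow> 'i \<Rightarrow>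
   'gv :: complex_hilbert \<Rightarrow> 'gv" where
  \<comment> \<open>\<open>L\<^sub>i \<otimes> 1\<close>\<close>
  "creation_id F G i = (THE S. bounded_clinear S \<and> (\<forall>g v. S (G g v) = G (creation F i g) v))"

definition fock_tensor :: "('g \<Rightarrow> 'v \<Rightarrow> 'gv :: complex_hilbert) \<Rightarrow> 'v set \<Rightarrow> 'gv set" where
  \<comment> \<open>the subspace \<open>\<Gamma> \<otimes> D\<close> for a closed subspace \<open>D\<close>\<close>
  "fock_tensor G D = closure (cspan {G g v |g v. v \<in> D})"

definition popescu_V ::
  "(('i, complex) l2 list \<Rightarrow> 'g :: complex_hilbert) \<Rightarrow> ('g \<Rightarrow> ('i, 'h) l2 \<Rightarrow> 'gh) \<Rightarrow>
   ('i \<Rightarrow> 'h :: complex_hilbert \<Rightarrow> 'h) \<Rightarrow> 'i \<Rightarrow> 'h \<times> 'gh :: complex_hilbert \<Rightarrow> 'h \<times> 'gh" where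
  "popescu_V F G A i = (\<lambda>(h, \<xi>). (A i h, G (F []) (defect A (l2_single i h)) + creation_id F G i \<xi>))"

end

theory Submission
  imports Defs
begin

text \<open>Let \<open>\<iota> h = h \<otimes> \<Omega>\<close> be the embedding of \<open>\<H>\<close> and \<open>S i = 1 \<otimes> s i\<close>. The infinite product formula
  gives \<open>wt (t i x) = S i (wt x)\<close> and maps the vacuum to the vacuum. Since \<open>\<iota> h\<close> is the sum of the
  \<open>t i (\<iota> (A\<^sub>i\<^sup>* h))\<close>, for every bounded \<open>R\<close> on \<open>\<H>\<close> of the form \<open>Q \<circ> wt \<circ> \<iota>\<close>, where \<open>Q\<close> intertwines the
  \<open>S i\<close> with isometries with orthogonal ranges, the operator \<open>R\<^sup>* R\<close> is a fixed point of
  \<open>Z(x) = \<Sum>\<^sub>i A\<^sub>i x A\<^sub>i\<^sup>*\<close> and hence a scalar, which is evaluated at the vacuum. Taking for \<open>Q\<close> the identity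
  and the adjoint of \<open>y \<mapsto> \<Omega>\<^sub>\<H> \<otimes> y\<close> shows that \<open>wt \<circ> \<iota>\<close> is an isometry into \<open>\<Omega>\<^sub>\<H> \<otimes> \<P>\<^sup>\<infinity>\<close>; the
  intertwining relations extend this to \<open>Hhat\<close>, and the range is everything because it is closed,
  invariant under the \<open>s i\<close> and contains the vacuum. The unitary \<open>W\<close> maps \<open>\<Omega>\<^sub>\<H>\<close> to \<open>1\<close>, so it
  maps the orthogonal complement \<open>0 \<oplus> (\<Gamma> \<otimes> D\<^sub>A)\<close> of \<open>\<H>\<close> into the complement of \<open>1\<close>.\<close>

section \<open>Operators on complex Hilbert spaces\<close>

lemma cinner_zero [simp]: "cinner 0 x = 0" "cinner x 0 = 0" for x :: "'a :: complex_hilbert"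
  by (metis add_cancel_right_right cinner_add_left add_0)
    (metis add_cancel_right_right cinner_add_right add_0)

lemma cinner_minus_right: "cinner x (- y) = - cinner x y" for x :: "'a :: complex_hilbert"
  using cinner_add_right[of x y "- y"] by (simp add: eq_neg_iff_add_eq_0 add.commute)

lemma cinner_diff_right: "cinner x (y - z) = cinner x y - cinner x z" for x :: "'a :: complex_hilbert"
  using cinner_add_right[of x y "- z"] by (simp add: cinner_minus_right)

lemma cinner_diff_left: "cinner (x - y) z = cinner x z - cinner y z" for x :: "'a :: complex_hilbert"
  by (metis cinner_commute cinner_diff_right complex_cnj_diff)

lemma cinner_self_eq_0 [simp]: "cinner x x = 0 \<longleftrightarrow> x = 0" for x :: "'a :: complex_hilbert"
  by (simp add: cinner_self)

lemma bounded_clinearI: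
  assumes "\<And>x y. T (x + y) = T x + T y" "\<And>c x. T (c *\<^sub>C x) = c *\<^sub>C T x" "\<And>x. norm (T x) \<le> norm x * K"
  shows "bounded_clinear T"
  unfolding bounded_clinear_def
  by (auto intro!: bounded_linear_intro[where K = K] assms simp: scaleR_scaleC)

lemma bounded_clinear_cinner: "bounded_clinear (cinner x)"
  by (rule bounded_clinearI[where K = "norm x"])
    (simp_all add: cinner_add_right cinner_scaleC_right scaleC_complex_def complex_Cauchy_Schwarz
      mult.commute[of _ "norm x"])

lemma bounded_clinear_bounded_linear: "bounded_clinear T \<Longrightarrow> bounded_linear T"
  by (simp add: bounded_clinear_def)

lemma bounded_clinear_scaleC: "bounded_clinear T \<Longrightarrow> T (c *\<^sub>C x) = c *\<^sub>C T x"
  by (simp add: bounded_clinear_def)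

lemmas bounded_clinear_add = linear_add[OF bounded_linear.linear[OF bounded_clinear_bounded_linear]]
lemmas bounded_clinear_diff = linear_diff[OF bounded_linear.linear[OF bounded_clinear_bounded_linear]]
lemmas bounded_clinear_zero = linear_0[OF bounded_linear.linear[OF bounded_clinear_bounded_linear]]
lemmas bounded_clinear_tendsto = bounded_linear.tendsto[OF bounded_clinear_bounded_linear]
lemmas bounded_clinear_has_sum = has_sum_bounded_linear[OF bounded_clinear_bounded_linear]

lemma bounded_clinear_continuous_on: "bounded_clinear T \<Longrightarrow> continuous_on X T"
  by (simp add: bounded_clinear_bounded_linear linear_continuous_on)

lemma bounded_clinear_compose:
  assumes "bounded_clinear S" "bounded_clinear T"
  shows "bounded_clinear (\<lambda>x. S (T x))"
  using assms bounded_linear_compose unfolding bounded_clinear_def by auto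

lemma bounded_clinear_ident: "bounded_clinear (\<lambda>x. x)"
  by (simp add: bounded_clinear_def bounded_linear_ident)

lemma bounded_clinear_scale:
  assumes "bounded_clinear T" shows "bounded_clinear (\<lambda>x. a *\<^sub>C T x)"
proof -
  obtain K where K: "\<And>x. norm (T x) \<le> norm x * K"
    using bounded_linear.bounded[OF bounded_clinear_bounded_linear[OF assms]] by blast
  show ?thesis
    by (rule bounded_clinearI[where K = "cmod a * K"])
      (use mult_left_mono[OF K norm_ge_zero[of a]] in \<open>simp_all add: bounded_clinear_add[OF assms]
        bounded_clinear_scaleC[OF assms] scaleC_add_right scaleC_scaleC norm_scaleC mult_ac\<close>)
qed

lemma bounded_clinear_mult: "bounded_clinear (f :: 'a :: complex_hilbert \<Rightarrow> complex) \<Longrightarrow> bounded_clinear (\<lambda>x. a * f x)"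
  using bounded_clinear_scale[of f a] by (simp add: scaleC_complex_def)

lemma bounded_clinear_vimage:
  assumes "bounded_clinear T" "closed X" "cvec.subspace X"
  shows "closed {x. T x \<in> X}" "cvec.subspace {x. T x \<in> X}"
proof -
  show "closed {x. T x \<in> X}"
    using closed_vimage[OF assms(2) bounded_clinear_continuous_on[OF assms(1)]] by (simp add: vimage_def)
  show "cvec.subspace {x. T x \<in> X}"
    using assms(1,3) unfolding cvec.subspace_def
    by (auto simp: bounded_clinear_zero bounded_clinear_add bounded_clinear_scaleC)
qed

section \<open>Closed subspaces and arguments by density\<close>

lemma csubspace_closure:
  assumes "cvec.subspace X" shows "cvec.subspace (closure X)"
  unfolding cvec.subspace_def
proof (intro conjI ballI allI)
  show "0 \<in> closure X" using assms closure_subset by (auto simp: cvec.subspace_def)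
next
  fix p q assume "p \<in> closure X" "q \<in> closure X"
  then obtain P Q where PQ: "\<And>n. P n \<in> X" "P \<longlonglongrightarrow> p" "\<And>n. Q n \<in> X" "Q \<longlonglongrightarrow> q"
    unfolding closure_sequential by blast
  have "\<And>n. P n + Q n \<in> X" using assms PQ(1,3) by (simp add: cvec.subspace_def)
  then show "p + q \<in> closure X" unfolding closure_sequential
    using tendsto_add[OF PQ(2,4)] by (intro exI[of _ "\<lambda>n. P n + Q n"]) auto
next
  fix a p assume "p \<in> closure X"
  then obtain P where P: "\<And>n. P n \<in> X" "P \<longlonglongrightarrow> p"
    unfolding closure_sequential by blast
  have "\<And>n. a *\<^sub>C P n \<in> X" using assms P(1) by (simp add: cvec.subspace_def)
  then show "a *\<^sub>C p \<in> closure X" unfolding closure_sequential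
    using bounded_clinear_tendsto[OF bounded_clinear_scale[OF bounded_clinear_ident] P(2)]
    by (intro exI[of _ "\<lambda>n. a *\<^sub>C P n"]) auto
qed

lemma total_induct:
  assumes "closure (cspan E) = UNIV" "E \<subseteq> X" "closed X" "cvec.subspace X"
  shows "x \<in> X"
  using closure_minimal[OF cvec.span_minimal[OF assms(2,4)] assms(3)] assms(1) by auto

text \<open>The set on which two bounded operators agree is a closed subspace.\<close>

lemma bounded_clinear_eq_closure:
  assumes "bounded_clinear S" "bounded_clinear T" "\<And>x. x \<in> E \<Longrightarrow> S x = T x" "x \<in> closure (cspan E)"
  shows "S x = T x"
proof -
  have "closed {x. S x = T x}"
    by (intro closed_Collect_eq bounded_clinear_continuous_on assms)
  moreover have "cvec.subspace {x. S x = T x}"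
    using assms(1,2) unfolding cvec.subspace_def
    by (auto simp: bounded_clinear_zero bounded_clinear_add bounded_clinear_scaleC)
  ultimately have "closure (cspan E) \<subseteq> {x. S x = T x}"
    using assms(3) by (intro closure_minimal cvec.span_minimal) auto
  then show ?thesis using assms(4) by auto
qed

lemma bounded_clinear_eqI:
  assumes "closure (cspan E) = UNIV" "bounded_clinear S" "bounded_clinear T" "\<And>x. x \<in> E \<Longrightarrow> S x = T x"
  shows "S x = T x"
  using bounded_clinear_eq_closure[OF assms(2-4)] assms(1) by simp

text \<open>The difference \<open>a - b\<close> is orthogonal to a total set, hence to
  itself.\<close>

lemma total_cinner_eqI:
  assumes "closure (cspan E) = UNIV" "\<And>x. x \<in> E \<Longrightarrow> cinner x a = cinner x b"
  shows "a = b"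
proof -
  have "cinner (a - b) x = cinner 0 x" for x
  proof (rule bounded_clinear_eqI[OF assms(1) bounded_clinear_cinner bounded_clinear_cinner])
    show "cinner (a - b) x = cinner 0 x" if "x \<in> E" for x
      using assms(2)[OF that] cinner_commute[of a x] cinner_commute[of b x] by (simp add: cinner_diff_left)
  qed
  from this[of "a - b"] show ?thesis by simp
qed

lemma cinner_ext: "(\<And>x. cinner x a = cinner x b) \<Longrightarrow> a = (b :: 'a :: complex_hilbert)"
  by (metis cinner_diff_right cinner_self_eq_0 eq_iff_diff_eq_0)

text \<open>The inner product is linear only in its second argument, so that argument is extended
  first, and the other one after exchanging the two, which turns \<open>c\<close> into
  \<open>cnj c\<close>. Having two operators and a factor \<open>c\<close> also covers pairs such as
  \<open>t i\<close>, \<open>t j\<close>, where the factor is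
  \<open>cinner (\<epsilon> i) (\<epsilon> j)\<close>.\<close>

lemma cinner_closure_form:
  assumes S: "bounded_clinear S" "bounded_clinear T"
    and eq: "\<And>x y. x \<in> E \<Longrightarrow> y \<in> E \<Longrightarrow> cinner (S x) (T y) = c * cinner x y"
    and ab: "a \<in> closure (cspan E)" "b \<in> closure (cspan E)"
  shows "cinner (S a) (T b) = c * cinner a b"
proof -
  have 1: "cinner (S x) (T b) = c * cinner x b" if "x \<in> E" for x
    by (rule bounded_clinear_eq_closure[OF bounded_clinear_compose[OF bounded_clinear_cinner S(2)]
          bounded_clinear_mult[OF bounded_clinear_cinner] _ ab(2)]) (use eq that in auto)
  have "cinner (T b) (S a) = cnj c * cinner b a"
  proof (rule bounded_clinear_eq_closure[OF bounded_clinear_compose[OF bounded_clinear_cinner S(1)]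
          bounded_clinear_mult[OF bounded_clinear_cinner] _ ab(1)])
    show "cinner (T b) (S x) = cnj c * cinner b x" if "x \<in> E" for x
      using 1[OF that] by (metis cinner_commute complex_cnj_mult)
  qed
  then show ?thesis
    by (metis cinner_commute complex_cnj_cnj complex_cnj_mult)
qed

lemma cinner_total_form:
  assumes "closure (cspan (range e)) = UNIV" "bounded_clinear S" "bounded_clinear T"
    and "\<And>x y. cinner (S (e x)) (T (e y)) = c * cinner (e x) (e y)"
  shows "cinner (S a) (T b) = c * cinner a b"
  by (rule cinner_closure_form[OF assms(2,3), where E = "range e"]) (use assms(1,4) in auto)

section \<open>Norm identities and polarization\<close>

lemma norm_add_square: "(norm (x + y))\<^sup>2 = (norm x)\<^sup>2 + (norm y)\<^sup>2 + 2 * Re (cinner x y)"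
  for x :: "'a :: complex_hilbert"
proof -
  have "complex_of_real ((norm (x + y))\<^sup>2)
      = of_real ((norm x)\<^sup>2) + of_real ((norm y)\<^sup>2) + (cinner x y + cnj (cinner x y))"
    unfolding cinner_self[symmetric] cinner_commute[of y x, symmetric]
    by (simp add: cinner_add_left cinner_add_right)
  then have "Re (complex_of_real ((norm (x + y))\<^sup>2))
      = Re (of_real ((norm x)\<^sup>2) + of_real ((norm y)\<^sup>2) + (cinner x y + cnj (cinner x y)))"
    by metis
  then show ?thesis by simp
qed

lemma norm_diff_square: "(norm (x - y))\<^sup>2 = (norm x)\<^sup>2 + (norm y)\<^sup>2 - 2 * Re (cinner x y)"
  for x :: "'a :: complex_hilbert"
  using norm_add_square[of x "- y"] by (simp add: cinner_minus_right)

lemma parallelogram: "(norm (x + y))\<^sup>2 + (norm (x - y))\<^sup>2 = 2 * (norm x)\<^sup>2 + 2 * (norm y)\<^sup>2"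
  for x :: "'a :: complex_hilbert"
  by (simp add: norm_add_square norm_diff_square)

text \<open>Polarization: norms of sums determine the real part of the inner product, and replacing
  \<open>y\<close> by \<open>\<i> *\<^sub>C y\<close> gives the imaginary part. As \<open>T\<close>
  is controlled only on \<open>X\<close>, all vectors involved must stay in the subspace
  \<open>X\<close>.\<close>

lemma isometry_on_cinner:
  assumes T: "isometry_on T X Y" and X: "cvec.subspace X" and xy: "x \<in> X" "y \<in> X"
  shows "cinner (T x) (T y) = cinner x y"
proof -
  have re: "Re (cinner (T a) (T b)) = Re (cinner a b)" if "a \<in> X" "b \<in> X" for a b
  proof -
    have "a + b \<in> X" using that X by (simp add: cvec.subspace_def)
    then have "(norm (T a + T b))\<^sup>2 = (norm (a + b))\<^sup>2"
      using T that unfolding isometry_on_def by metis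
    then show ?thesis using T that by (simp add: norm_add_square isometry_on_def)
  qed
  have "\<i> *\<^sub>C y \<in> X" using xy X by (simp add: cvec.subspace_def)
  from re[OF xy(1) this] have "Re (\<i> * cinner (T x) (T y)) = Re (\<i> * cinner x y)"
    using T xy by (simp add: isometry_on_def cinner_scaleC_right)
  with re[OF xy] show ?thesis by (simp add: complex_eq_iff)
qed

lemma bounded_clinear_isometry: "isometry_on T UNIV UNIV \<Longrightarrow> bounded_clinear T"
  by (rule bounded_clinearI[where K = 1]) (simp_all add: isometry_on_def)

lemma norm_eq_if_cinner_eq:
  fixes x :: "'a :: complex_hilbert" and y :: "'b :: complex_hilbert"
  assumes "cinner x x = cinner y y" shows "norm x = norm y"
proof -
  have "complex_of_real ((norm x)\<^sup>2) = of_real ((norm y)\<^sup>2)"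
    using assms by (simp only: cinner_self)
  then have "(norm x)\<^sup>2 = (norm y)\<^sup>2" using of_real_eq_iff by blast
  then show ?thesis by simp
qed

subsection \<open>Adjoints\<close>

text \<open>The vector \<open>z\<close> of least norm on the affine hyperplane
  \<open>f x = 1\<close> is orthogonal to the kernel of \<open>f\<close>, and a multiple of
  \<open>z\<close> represents \<open>f\<close>.\<close>

lemma riesz_representation:
  fixes f :: "'a :: complex_hilbert \<Rightarrow> complex"
  assumes f: "bounded_clinear f"
  shows "\<exists>v. \<forall>x. f x = cinner v x"
proof (cases "\<forall>x. f x = 0")
  case True
  then show ?thesis by (intro exI[of _ 0]) simp
next
  case False
  then obtain x0 where x0: "f x0 \<noteq> 0" by blast
  define C where "C = {x. f x = 1}"
  have fl: "f (x + y) = f x + f y" "f (c *\<^sub>C x) = c * f x" "f (x - y) = f x - f y" "f 0 = 0" for x y c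
    using bounded_clinear_add[OF f] bounded_clinear_scaleC[OF f] bounded_clinear_diff[OF f]
      bounded_clinear_zero[OF f] by (auto simp: scaleC_complex_def)
  have ne: "(1 / f x0) *\<^sub>C x0 \<in> C" using x0 by (simp add: C_def fl)
  define m where "m = Inf (norm ` C)"
  have bdd: "bdd_below (norm ` C)" by (rule bdd_belowI[of _ 0]) auto
  have mle: "m \<le> norm x" if "x \<in> C" for x
    unfolding m_def using that bdd by (auto intro: cInf_lower)
  have m0: "m \<ge> 0" unfolding m_def using ne by (intro cInf_greatest) auto
  have "\<exists>x\<in>C. norm x < m + inverse (real (Suc n))" for n
  proof -
    have "\<exists>r\<in>norm ` C. r < m + inverse (real (Suc n))"
      unfolding m_def by (rule cInf_lessD) (use ne in auto)
    then show ?thesis by auto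
  qed
  then obtain X where X: "\<And>n. X n \<in> C" "\<And>n. norm (X n) < m + inverse (real (Suc n))" by metis
  \<comment> \<open>Midpoints of points of \<open>C\<close> lie in \<open>C\<close> and so have norm
    at least \<open>m\<close>; by the parallelogram law a minimizing sequence is then
    Cauchy.\<close>
  have mid: "(norm (x - y))\<^sup>2 \<le> 2 * (norm x)\<^sup>2 + 2 * (norm y)\<^sup>2 - 4 * m\<^sup>2" if "x \<in> C" "y \<in> C" for x y
  proof -
    have "(1/2) *\<^sub>C (x + y) \<in> C" using that by (simp add: C_def fl)
    from mle[OF this] have "m \<le> norm (x + y) / 2" by (simp add: norm_scaleC)
    then have "(2 * m)\<^sup>2 \<le> (norm (x + y))\<^sup>2" using m0 by (intro power_mono) auto
    then show ?thesis using parallelogram[of x y] by (simp add: power_mult_distrib)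
  qed
  have nX: "(\<lambda>n. norm (X n)) \<longlonglongrightarrow> m"
  proof (rule tendsto_sandwich[OF _ _ tendsto_const])
    show "(\<lambda>n. m + inverse (real (Suc n))) \<longlonglongrightarrow> m"
      using tendsto_add[OF tendsto_const LIMSEQ_inverse_real_of_nat] by simp
  qed (use X mle in \<open>auto intro!: always_eventually less_imp_le\<close>)
  have "Cauchy X"
  proof (rule metric_CauchyI)
    fix e :: real assume e: "e > 0"
    have "(\<lambda>n. 2 * (norm (X n))\<^sup>2 - 2 * m\<^sup>2) \<longlonglongrightarrow> 2 * m\<^sup>2 - 2 * m\<^sup>2"
      by (intro tendsto_intros nX)
    then have "(\<lambda>n. 2 * (norm (X n))\<^sup>2 - 2 * m\<^sup>2) \<longlonglongrightarrow> 0" by simp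
    then have "\<forall>\<^sub>F n in sequentially. 2 * (norm (X n))\<^sup>2 - 2 * m\<^sup>2 < e\<^sup>2 / 2"
      by (rule order_tendstoD) (use e in simp)
    then obtain N where N: "\<And>n. n \<ge> N \<Longrightarrow> 2 * (norm (X n))\<^sup>2 - 2 * m\<^sup>2 < e\<^sup>2 / 2"
      by (auto simp: eventually_sequentially)
    have "dist (X k) (X n) < e" if "k \<ge> N" "n \<ge> N" for k n
    proof -
      have "(norm (X k - X n))\<^sup>2 < e\<^sup>2"
        using mid[OF X(1)[of k] X(1)[of n]] N[OF that(1)] N[OF that(2)] by linarith
      then show ?thesis using e by (simp add: dist_norm power_less_imp_less_base)
    qed
    then show "\<exists>M. \<forall>m\<ge>M. \<forall>n\<ge>M. dist (X m) (X n) < e" by blast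
  qed
  then obtain z where z: "X \<longlonglongrightarrow> z" by (auto simp: Cauchy_convergent_iff convergent_def)
  have "(\<lambda>n. f (X n)) \<longlonglongrightarrow> f z" by (rule bounded_clinear_tendsto[OF f z])
  then have fz: "f z = 1" using X(1) by (simp add: C_def LIMSEQ_const_iff)
  have nz: "norm z = m" using tendsto_norm[OF z] nX LIMSEQ_unique by blast
  have orth: "cinner z x = 0" if x: "f x = 0" for x
  proof (rule ccontr)
    assume c: "cinner z x \<noteq> 0"
    then have x: "x \<noteq> 0" "f x = 0" using x by auto
    \<comment> \<open>With this \<open>a\<close>, the vector \<open>a *\<^sub>C x\<close> is the
      projection of \<open>z\<close> onto the line through \<open>x\<close>. Subtracting it would
      stay in \<open>C\<close> and strictly lower the norm.\<close>
    define a where "a = cnj (cinner z x) / of_real ((norm x)\<^sup>2)"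
    have "m \<le> norm (z - a *\<^sub>C x)" by (rule mle) (simp add: C_def fl fz x)
    then have "m\<^sup>2 \<le> (norm (z - a *\<^sub>C x))\<^sup>2" using m0 by (intro power_mono)
    then have "2 * Re (a * cinner z x) \<le> (cmod a)\<^sup>2 * (norm x)\<^sup>2"
      by (simp add: norm_diff_square nz cinner_scaleC_right norm_scaleC power_mult_distrib)
    moreover have "a * cinner z x = of_real ((cmod (cinner z x))\<^sup>2 / (norm x)\<^sup>2)"
      using complex_norm_square[of "cinner z x"] by (simp add: a_def mult.commute)
    then have "Re (a * cinner z x) = (cmod (cinner z x))\<^sup>2 / (norm x)\<^sup>2" by (metis Re_complex_of_real)
    moreover have "(cmod a)\<^sup>2 * (norm x)\<^sup>2 = (cmod (cinner z x))\<^sup>2 / (norm x)\<^sup>2"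
      using x by (simp add: a_def norm_divide power_divide power2_eq_square norm_mult)
    ultimately have "(cmod (cinner z x))\<^sup>2 / (norm x)\<^sup>2 \<le> 0" by linarith
    moreover have "(cmod (cinner z x))\<^sup>2 / (norm x)\<^sup>2 > 0" using c x by simp
    ultimately show False by linarith
  qed
  have z0: "z \<noteq> 0" using fz fl(4) by auto
  have "f x = cinner ((1 / of_real ((norm z)\<^sup>2)) *\<^sub>C z) x" for x
  proof -
    \<comment> \<open>The vector \<open>x - f x *\<^sub>C z\<close> lies in the kernel because
      \<open>f z = 1\<close>.\<close>
    have "cinner z (x - f x *\<^sub>C z) = 0" by (rule orth) (simp add: fl fz)
    then have "cinner z x = f x * of_real ((norm z)\<^sup>2)"
      by (simp add: cinner_diff_right cinner_scaleC_right cinner_self)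
    then show ?thesis using z0 by (simp add: cinner_scaleC_left)
  qed
  then show ?thesis by blast
qed

text \<open>Riesz representation in each \<open>y\<close> gives the adjoint pointwise. Its bound
  follows from \<open>cinner (S x) (S x) = cinner x (T (S x))\<close> by Cauchy-Schwarz, after
  cancelling one factor \<open>norm (S x)\<close>.\<close>

lemma hadj:
  fixes T :: "'a :: complex_hilbert \<Rightarrow> 'b :: complex_hilbert"
  assumes T: "bounded_clinear T"
  shows bounded_clinear_hadj: "bounded_clinear (hadj T)"
    and cinner_hadj_left: "cinner (hadj T y) x = cinner y (T x)"
proof -
  have "\<exists>v. \<forall>x. cinner y (T x) = cinner v x" for y
    by (rule riesz_representation, rule bounded_clinear_compose[OF bounded_clinear_cinner T])
  then obtain S where S: "\<And>y x. cinner (S y) x = cinner y (T x)" by metis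
  have S': "cinner x (S y) = cinner (T x) y" for x y by (metis S cinner_commute)
  obtain K where K: "\<And>x. norm (T x) \<le> norm x * K" "K \<ge> 0"
    using bounded_linear.nonneg_bounded[OF bounded_clinear_bounded_linear[OF T]] by blast
  have bS: "bounded_clinear S"
  proof (rule bounded_clinearI[where K = K])
    fix x y c
    show "S (x + y) = S x + S y" "S (c *\<^sub>C x) = c *\<^sub>C S x"
      by (rule cinner_ext, simp add: S' cinner_add_right cinner_scaleC_right)+
    have "(norm (S x))\<^sup>2 = cmod (cinner (S x) (S x))" by (simp only: cinner_self) (simp add: norm_power)
    also have "\<dots> \<le> norm x * norm (T (S x))" unfolding S by (rule complex_Cauchy_Schwarz)
    also have "\<dots> \<le> norm x * (norm (S x) * K)" by (intro mult_left_mono K) simp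
    finally have "norm (S x) * norm (S x) \<le> (norm x * K) * norm (S x)"
      by (simp add: power2_eq_square mult_ac)
    then show "norm (S x) \<le> norm x * K"
      using K(2) by (cases "norm (S x) = 0") (auto dest: mult_right_le_imp_le)
  qed
  have "hadj T = S" unfolding hadj_def
  proof (rule the_equality)
    fix R assume "bounded_clinear R \<and> (\<forall>y x. cinner (R y) x = cinner y (T x))"
    then have "cinner x (R y) = cinner x (S y)" for x y by (metis S cinner_commute)
    then show "R = S" by (metis ext cinner_ext)
  qed (use bS S in auto)
  then show "bounded_clinear (hadj T)" "cinner (hadj T y) x = cinner y (T x)" using bS S by auto
qed

lemma cinner_hadj_right: "bounded_clinear T \<Longrightarrow> cinner x (hadj T y) = cinner (T x) y"
  by (metis cinner_hadj_left cinner_commute)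

text \<open>\<open>T\<close> after \<open>hadj T\<close> is the projection onto the range of
  \<open>T\<close>, so a vector whose norm survives \<open>hadj T\<close> lies in that range.
  Concretely, all four terms in the square of the norm of \<open>T (hadj T y) - y\<close> equal
  \<open>cinner y y\<close> up to sign.\<close>

lemma isometry_range_if_norm_hadj:
  assumes T: "bounded_clinear T" "\<And>x y. cinner (T x) (T y) = cinner x y"
    and y: "cinner (hadj T y) (hadj T y) = cinner y y"
  shows "T (hadj T y) = y"
proof -
  have "cinner y (T (hadj T y)) = cinner y y" "cinner (T (hadj T y)) y = cinner y y"
    using y cinner_hadj_left[OF T(1)] cinner_hadj_right[OF T(1)] by metis+
  then have "cinner (T (hadj T y) - y) (T (hadj T y) - y) = 0"
    by (simp add: cinner_diff_left cinner_diff_right T(2) y)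
  then show ?thesis by simp
qed

lemma hadj_isometry:
  assumes "bounded_clinear T" "\<And>x y. cinner (T x) (T y) = cinner x y"
  shows "hadj T (T x) = x"
  by (rule cinner_ext) (simp add: assms cinner_hadj_right)

text \<open>Reads off one component of an orthogonal sum: \<open>z\<close> is taken from the
  \<open>i\<close>-th of several orthogonal ranges and sees only the \<open>i\<close>-th
  term.\<close>

lemma cinner_has_sum_single:
  assumes f: "(f has_sum v) UNIV" and z: "\<And>j. cinner z (f j) = (if j = i then c else 0)"
  shows "cinner z v = c"
proof -
  have "((\<lambda>j. cinner z (f j)) has_sum cinner z v) UNIV"
    by (rule bounded_clinear_has_sum[OF bounded_clinear_cinner f])
  moreover have "((\<lambda>j. cinner z (f j)) has_sum c) UNIV"
    by (rule has_sum_finite_neutralI[of "{i}"]) (simp_all add: z)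
  ultimately show ?thesis by (rule has_sum_unique)
qed

lemma ergodic_intertwiner:
  assumes A: "\<And>i. bounded_clinear (A i)" "ergodic A"
    and s: "\<And>i j x y. cinner (s i x) (s j y) = (if i = j then cinner x y else 0)"
    and R: "bounded_clinear R" "\<And>h. ((\<lambda>i. s i (R (hadj (A i) h))) has_sum R h) UNIV"
  shows "\<exists>c. \<forall>h h'. cinner (R h) (R h') = c * cinner h h'"
proof -
  \<comment> \<open>In operator form: the adjoint of \<open>s i\<close> after \<open>R\<close>
    equals \<open>R\<close> after \<open>hadj (A i)\<close>. Fact 2 is the adjoint relation;
    applying \<open>hadj R\<close> to the expansion of \<open>R h\<close> and using it shows that
    \<open>hadj R\<close> after \<open>R\<close> is fixed by the map in
    \<open>ergodic\<close>.\<close>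
  have 1: "cinner (s i y) (R h) = cinner y (R (hadj (A i) h))" for i y h
    by (rule cinner_has_sum_single[OF R(2), where i = i]) (simp add: s)
  have 2: "A i (hadj R y) = hadj R (s i y)" for i y
  proof (rule cinner_ext)
    fix h
    have "cinner h (A i (hadj R y)) = cinner (R (hadj (A i) h)) y"
      by (simp add: cinner_hadj_left[OF A(1), symmetric] cinner_hadj_right[OF R(1)])
    also have "\<dots> = cinner h (hadj R (s i y))"
      by (metis 1 cinner_commute cinner_hadj_right[OF R(1)])
    finally show "cinner h (A i (hadj R y)) = cinner h (hadj R (s i y))" .
  qed
  have "((\<lambda>i. A i (hadj R (R (hadj (A i) h)))) has_sum hadj R (R h)) UNIV" for h
    unfolding 2 by (rule bounded_clinear_has_sum[OF bounded_clinear_hadj[OF R(1)] R(2)])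
  moreover have "bounded_clinear (\<lambda>h. hadj R (R h))"
    by (rule bounded_clinear_compose[OF bounded_clinear_hadj[OF R(1)] R(1)])
  ultimately have "\<exists>c. \<forall>h. hadj R (R h) = c *\<^sub>C h"
    using A(2) unfolding ergodic_def by blast
  then obtain c where c: "\<And>h. hadj R (R h) = c *\<^sub>C h" by blast
  have "cinner (R h) (R h') = c * cinner h h'" for h h'
    unfolding cinner_hadj_right[OF R(1), symmetric] c cinner_scaleC_right ..
  then show ?thesis by blast
qed

subsection \<open>Operators defined on a total family\<close>

text \<open>The operator is obtained from its graph, the closed span of the pairs
  \<open>(e x, g x)\<close>. The hypothesis on inner products extends to the span and fixes the norm
  of the second component in terms of the first, so the closed graph is single-valued and, by
  completeness, defined everywhere.\<close>

lemma bounded_clinear_total_ext: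
  fixes e :: "'x \<Rightarrow> 'a :: complex_hilbert" and g :: "'x \<Rightarrow> 'b :: complex_hilbert"
  assumes E: "closure (cspan (e ` X)) = UNIV"
    and ip: "\<And>x y. x \<in> X \<Longrightarrow> y \<in> X \<Longrightarrow> cinner (g x) (g y) = c * cinner (e x) (e y)"
  shows "\<exists>S. bounded_clinear S \<and> (\<forall>x\<in>X. S (e x) = g x)"
proof -
  define G where "G = closure (cspan ((\<lambda>x. (e x, g x)) ` X))"
  have prod: "fst (p + q) = fst p + fst q" "snd (p + q) = snd p + snd q"
    "fst (a *\<^sub>C p) = a *\<^sub>C fst p" "snd (a *\<^sub>C p) = a *\<^sub>C snd p" for p q :: "'a \<times> 'b" and a
    by (simp_all add: scaleC_prod_def)
  have 1: "cinner (g x) (snd q) = c * cinner (e x) (fst q)"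
    if "x \<in> X" "q \<in> cspan ((\<lambda>x. (e x, g x)) ` X)" for x q
    using that(2)
  proof (induction rule: cvec.span_induct)
    case base
    show ?case
      by (auto simp: cvec.subspace_def cinner_add_right cinner_scaleC_right prod algebra_simps)
  qed (use ip that(1) in auto)
  have 2: "cinner (snd q) (snd p) = c * cinner (fst q) (fst p)"
    if "p \<in> cspan ((\<lambda>x. (e x, g x)) ` X)" "q \<in> cspan ((\<lambda>x. (e x, g x)) ` X)" for p q
    using that(2)
  proof (induction rule: cvec.span_induct)
    case base
    show ?case
      by (auto simp: cvec.subspace_def cinner_add_left cinner_scaleC_left prod algebra_simps)
  qed (use 1 that(1) in auto)
  define K where "K = sqrt (cmod c)"
  have "norm (snd p) = norm (fst p) * K" if "p \<in> cspan ((\<lambda>x. (e x, g x)) ` X)" for p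
  proof -
    have "(norm (snd p))\<^sup>2 = cmod (cinner (snd p) (snd p))" by (simp only: cinner_self) (simp add: norm_power)
    also have "\<dots> = cmod c * cmod (cinner (fst p) (fst p))" by (simp only: 2[OF that that] norm_mult)
    also have "\<dots> = (norm (fst p) * K)\<^sup>2" by (simp only: cinner_self) (simp add: norm_power K_def power_mult_distrib)
    finally show ?thesis by (simp add: K_def)
  qed
  moreover have "closed {p :: 'a \<times> 'b. norm (snd p) = norm (fst p) * K}"
    by (intro closed_Collect_eq continuous_intros)
  ultimately have nG: "norm (snd p) = norm (fst p) * K" if "p \<in> G" for p
    using closure_minimal[of "cspan ((\<lambda>x. (e x, g x)) ` X)" "{p. norm (snd p) = norm (fst p) * K}"] that
    unfolding G_def by (metis (mono_tags, lifting) mem_Collect_eq subset_iff)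
  have subG: "cvec.subspace G" unfolding G_def by (intro csubspace_closure cvec.subspace_span)
  have minus: "p - q \<in> G" if "p \<in> G" "q \<in> G" for p q
    using subG that by (rule cvec.subspace_diff)
  have "\<exists>b. (a, b) \<in> G" for a
  proof -
    \<comment> \<open>The first components of the span of the pairs exhaust the span of
      \<open>e\<close>, which is dense; this supplies the approximating sequence \<open>P\<close>
      below.\<close>
    have lift: "cspan (e ` X) \<subseteq> {a. \<exists>b. (a, b) \<in> cspan ((\<lambda>x. (e x, g x)) ` X)}"
    proof (rule cvec.span_minimal)
      show "e ` X \<subseteq> {a. \<exists>b. (a, b) \<in> cspan ((\<lambda>x. (e x, g x)) ` X)}"
        by (auto intro!: cvec.span_base)
      show "cvec.subspace {a. \<exists>b. (a, b) \<in> cspan ((\<lambda>x. (e x, g x)) ` X)}"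
        unfolding cvec.subspace_def
      proof (intro conjI ballI allI; clarsimp)
        show "\<exists>b. (0, b) \<in> cspan ((\<lambda>x. (e x, g x)) ` X)"
          by (rule exI[of _ 0]) (metis cvec.span_zero zero_prod_def)
      next
        fix x y b b' assume "(x, b) \<in> cspan ((\<lambda>x. (e x, g x)) ` X)" "(y, b') \<in> cspan ((\<lambda>x. (e x, g x)) ` X)"
        from cvec.span_add[OF this] show "\<exists>b. (x + y, b) \<in> cspan ((\<lambda>x. (e x, g x)) ` X)" by auto
      next
        fix r x b assume "(x, b) \<in> cspan ((\<lambda>x. (e x, g x)) ` X)"
        from cvec.span_scale[OF this, of r] show "\<exists>b. (r *\<^sub>C x, b) \<in> cspan ((\<lambda>x. (e x, g x)) ` X)"
          by (auto simp: scaleC_prod_def)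
      qed
    qed
    obtain \<xi> where \<xi>: "\<And>n. \<xi> n \<in> cspan (e ` X)" "\<xi> \<longlonglongrightarrow> a"
      using E closure_sequential[of a "cspan (e ` X)"] by auto
    have "\<forall>n. \<exists>p. p \<in> cspan ((\<lambda>x. (e x, g x)) ` X) \<and> fst p = \<xi> n" using lift \<xi>(1) by force
    then obtain P where P: "\<And>n. P n \<in> cspan ((\<lambda>x. (e x, g x)) ` X)" "\<And>n. fst (P n) = \<xi> n" by metis
    have PG: "P n \<in> G" for n using P(1) closure_subset unfolding G_def by blast
    have "Cauchy (\<lambda>n. snd (P n))"
    proof (rule metric_CauchyI)
      fix r :: real assume r: "r > 0"
      have K0: "K \<ge> 0" by (simp add: K_def)
      have "Cauchy \<xi>" using \<xi>(2) by (rule LIMSEQ_imp_Cauchy)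
      then obtain N where N: "\<And>m n. m \<ge> N \<Longrightarrow> n \<ge> N \<Longrightarrow> dist (\<xi> m) (\<xi> n) < r / (K + 1)"
        using metric_CauchyD[of \<xi> "r / (K + 1)"] r K0 by auto
      have "dist (snd (P m)) (snd (P n)) < r" if "m \<ge> N" "n \<ge> N" for m n
      proof -
        have "dist (snd (P m)) (snd (P n)) = dist (\<xi> m) (\<xi> n) * K"
          using nG[OF minus[OF PG PG], of m n] by (simp add: dist_norm P)
        also have "\<dots> \<le> dist (\<xi> m) (\<xi> n) * (K + 1)" by (intro mult_left_mono) auto
        also have "\<dots> < r" using N[OF that] K0 by (simp add: pos_less_divide_eq)
        finally show ?thesis .
      qed
      then show "\<exists>M. \<forall>m\<ge>M. \<forall>n\<ge>M. dist (snd (P m)) (snd (P n)) < r" by blast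
    qed
    then obtain b where b: "(\<lambda>n. snd (P n)) \<longlonglongrightarrow> b" by (auto simp: Cauchy_convergent_iff convergent_def)
    have "(\<lambda>n. (fst (P n), snd (P n))) \<longlonglongrightarrow> (a, b)"
      by (rule tendsto_Pair[OF _ b]) (use \<xi> P in simp)
    then have "(a, b) \<in> closure G" unfolding closure_sequential using PG by auto
    then show ?thesis by (auto simp: G_def)
  qed
  then obtain S where S: "\<And>a. (a, S a) \<in> G" by metis
  \<comment> \<open>The difference of two pairs over \<open>a\<close> has first component 0, hence
    second component of norm 0.\<close>
  have uniq: "b = S a" if "(a, b) \<in> G" for a b
    using nG[OF minus[OF that S[of a]]] by simp
  have "bounded_clinear S"
  proof (rule bounded_clinearI[where K = K])
    fix x y a
    have "(x, S x) + (y, S y) \<in> G" "a *\<^sub>C (x, S x) \<in> G"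
      by (intro cvec.subspace_add[OF subG] cvec.subspace_scale[OF subG] S)+
    then show "S (x + y) = S x + S y" "S (a *\<^sub>C x) = a *\<^sub>C S x"
      by (auto simp: scaleC_prod_def intro!: uniq[symmetric])
    show "norm (S x) \<le> norm x * K" using nG[OF S] by simp
  qed
  moreover have "S (e x) = g x" if "x \<in> X" for x
  proof -
    have "(e x, g x) \<in> cspan ((\<lambda>x. (e x, g x)) ` X)" using that by (intro cvec.span_base) auto
    then show ?thesis using closure_subset uniq unfolding G_def by force
  qed
  ultimately show ?thesis by blast
qed

text \<open>Adjoining the complementary components makes a partially isometric assignment isometric.\<close>

lemma bounded_clinear_total_ext_partial:
  fixes e :: "'x \<Rightarrow> 'a :: complex_hilbert" and g :: "'x \<Rightarrow> 'b :: complex_hilbert"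
  assumes E: "closure (cspan (range e)) = UNIV"
    and ip: "\<And>x y. P x \<Longrightarrow> P y \<Longrightarrow> cinner (g x) (g y) = cinner (e x) (e y)"
    and orth: "\<And>x y. P x \<Longrightarrow> \<not> P y \<Longrightarrow> cinner (e x) (e y) = 0"
  shows "\<exists>S. bounded_clinear S \<and> (\<forall>x. S (e x) = (if P x then g x else 0))"
proof -
  have orth': "cinner (e y) (e x) = 0" if "P x" "\<not> P y" for x y
    using orth[OF that] cinner_commute[of "e y" "e x"] by simp
  have "\<exists>S. bounded_clinear S \<and> (\<forall>x\<in>UNIV. S (e x) = (if P x then (g x, 0) else (0, e x)))"
    by (rule bounded_clinear_total_ext[where c = 1, OF E])
      (auto simp: cinner_prod_def ip orth orth')
  then obtain S where S: "bounded_clinear S" "\<And>x. S (e x) = (if P x then (g x, 0) else (0, e x))" by auto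
  have "bounded_clinear (\<lambda>x. fst (S x))"
    using bounded_clinear_compose[OF _ S(1), of fst]
    by (simp add: bounded_clinear_def bounded_linear_fst scaleC_prod_def)
  then show ?thesis using S(2) by (intro exI[of _ "\<lambda>x. fst (S x)"]) auto
qed

text \<open>Operators given by \<open>THE\<close> through their values are well defined once some
  bounded operator has these values and \<open>P\<close> fixes all values on the total set
  \<open>E\<close>.\<close>

lemma bounded_clinear_the:
  assumes E: "closure (cspan E) = UNIV" and ex: "\<exists>S. bounded_clinear S \<and> P S"
    and det: "\<And>S S' x. P S \<Longrightarrow> P S' \<Longrightarrow> x \<in> E \<Longrightarrow> S x = S' x"
  shows "bounded_clinear (THE S. bounded_clinear S \<and> P S)" "P (THE S. bounded_clinear S \<and> P S)"
proof -
  from ex obtain S where S: "bounded_clinear S" "P S" by blast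
  have "\<exists>!S. bounded_clinear S \<and> P S"
  proof (rule ex1I[of _ S])
    show "bounded_clinear S \<and> P S" using S by blast
    fix S' assume S': "bounded_clinear S' \<and> P S'"
    show "S' = S"
    proof
      fix x
      show "S' x = S x"
        by (rule bounded_clinear_eqI[OF E]) (use S S' det in blast)+
    qed
  qed
  from theI'[OF this] show "bounded_clinear (THE S. bounded_clinear S \<and> P S)"
    "P (THE S. bounded_clinear S \<and> P S)" by simp_all
qed

subsection \<open>Tensor products\<close>

lemma total_mono:
  assumes "closure (cspan E) = UNIV" "E \<subseteq> F" shows "closure (cspan F) = UNIV"
  using closure_mono[OF cvec.span_mono[OF assms(2)]] assms(1) by auto

lemma totalI:
  assumes "\<And>X x. closed X \<Longrightarrow> cvec.subspace X \<Longrightarrow> E \<subseteq> X \<Longrightarrow> x \<in> X"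
  shows "closure (cspan E) = UNIV"
proof -
  have "x \<in> closure (cspan E)" for x
    by (rule assms[OF closed_closure csubspace_closure[OF cvec.subspace_span]])
      (use closure_subset cvec.span_superset in blast)
  then show ?thesis by blast
qed

text \<open>The common pattern behind \<open>tensor_assoc\<close>, \<open>dilation_t\<close>,
  \<open>insert_HK\<close> and \<open>creation_id\<close>, so that one existence lemma serves all of
  them.\<close>

definition tensor_lift ::
  "('a \<Rightarrow> 'b \<Rightarrow> 'c :: complex_hilbert) \<Rightarrow> ('a \<Rightarrow> 'b \<Rightarrow> 'd :: complex_hilbert) \<Rightarrow> 'c \<Rightarrow> 'd" where
  "tensor_lift E g = (THE S. bounded_clinear S \<and> (\<forall>a b. S (E a b) = g a b))"

lemma hilbert_tensor_cinner: "hilbert_tensor E \<Longrightarrow> cinner (E a b) (E a' b') = cinner a a' * cinner b b'"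
  by (simp add: hilbert_tensor_def)

lemma hilbert_tensor_total: "hilbert_tensor E \<Longrightarrow> closure (cspan (range (\<lambda>(a, b). E a b))) = UNIV"
  by (simp add: hilbert_tensor_def image_def)

lemma tensor_eqI:
  assumes "hilbert_tensor E" "bounded_clinear S" "bounded_clinear T" "\<And>a b. S (E a b) = T (E a b)"
  shows "S x = T x"
  by (rule bounded_clinear_eqI[OF hilbert_tensor_total[OF assms(1)] assms(2,3)]) (use assms(4) in auto)

lemma tensor_cinner_eqI:
  assumes "hilbert_tensor E" "\<And>a b. cinner (E a b) x = cinner (E a b) y"
  shows "x = y"
  by (rule total_cinner_eqI[OF hilbert_tensor_total[OF assms(1)]]) (use assms(2) in auto)

lemma tensor_form_eqI:
  assumes E: "hilbert_tensor E" and "bounded_clinear S" "bounded_clinear T"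
    and eq: "\<And>a b a' b'. cinner (S (E a b)) (T (E a' b')) = c * (cinner a a' * cinner b b')"
  shows "cinner (S x) (T y) = c * cinner x y"
proof (rule cinner_total_form[OF hilbert_tensor_total[OF E] assms(2,3)])
  fix p q
  show "cinner (S (case p of (a, b) \<Rightarrow> E a b)) (T (case q of (a, b) \<Rightarrow> E a b))
      = c * cinner (case p of (a, b) \<Rightarrow> E a b) (case q of (a, b) \<Rightarrow> E a b)"
    by (cases p; cases q) (simp add: eq hilbert_tensor_cinner[OF E])
qed

lemma tensor_lift:
  assumes E: "hilbert_tensor E"
    and ip: "\<And>a b a' b'. cinner (g a b) (g a' b') = c * (cinner a a' * cinner b b')"
  shows bounded_clinear_tensor_lift: "bounded_clinear (tensor_lift E g)"
    and tensor_lift_apply: "tensor_lift E g (E a b) = g a b"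
proof -
  have ex: "\<exists>S. bounded_clinear S \<and> (\<forall>x\<in>UNIV. S (case x of (a, b) \<Rightarrow> E a b) = (case x of (a, b) \<Rightarrow> g a b))"
    by (rule bounded_clinear_total_ext[where c = c, OF hilbert_tensor_total[OF E]])
      (auto simp: ip hilbert_tensor_cinner[OF E])
  have ex': "\<exists>S. bounded_clinear S \<and> (\<forall>a b. S (E a b) = g a b)" using ex by auto
  have "bounded_clinear (tensor_lift E g)" "\<forall>a b. tensor_lift E g (E a b) = g a b"
    unfolding tensor_lift_def by (rule bounded_clinear_the[OF hilbert_tensor_total[OF E] ex']; auto)+
  then show "bounded_clinear (tensor_lift E g)" "tensor_lift E g (E a b) = g a b" by auto
qed

lemma norm_hilbert_tensor:
  assumes "hilbert_tensor E" shows "norm (E a b) = norm a * norm b"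
proof -
  have "norm (E a b) = norm (of_real (norm a) * of_real (norm b) :: complex)"
    by (rule norm_eq_if_cinner_eq, subst hilbert_tensor_cinner[OF assms])
      (simp add: cinner_self norm_mult power_mult_distrib)
  then show ?thesis by (simp add: norm_mult)
qed

text \<open>Bilinearity is derived, not postulated: a vector is determined by its inner products
  with the elementary tensors, and these are linear in each factor.\<close>

lemma bounded_clinear_tensor:
  assumes E: "hilbert_tensor E"
  shows bounded_clinear_tensor_left: "bounded_clinear (\<lambda>a. E a b)"
    and bounded_clinear_tensor_right: "bounded_clinear (E a)"
proof -
  show "bounded_clinear (\<lambda>a. E a b)"
  proof (rule bounded_clinearI[where K = "norm b"])
    show "E (x + y) b = E x b + E y b" "E (c *\<^sub>C x) b = c *\<^sub>C E x b" for x y c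
      by (rule tensor_cinner_eqI[OF E], simp add: hilbert_tensor_cinner[OF E] cinner_add_right
          cinner_scaleC_right algebra_simps)+
  qed (simp add: norm_hilbert_tensor[OF E])
  show "bounded_clinear (E a)"
  proof (rule bounded_clinearI[where K = "norm a"])
    show "E a (x + y) = E a x + E a y" "E a (c *\<^sub>C x) = c *\<^sub>C E a x" for x y c
      by (rule tensor_cinner_eqI[OF E], simp add: hilbert_tensor_cinner[OF E] cinner_add_right
          cinner_scaleC_right algebra_simps)+
  qed (simp add: norm_hilbert_tensor[OF E])
qed

lemma tensor_total_right:
  assumes E: "hilbert_tensor E" and F: "closure (cspan F) = UNIV"
  shows "closure (cspan {E a b |a b. b \<in> F}) = UNIV"
proof (rule totalI)
  fix X x assume X: "closed X" "cvec.subspace X" "{E a b |a b. b \<in> F} \<subseteq> X"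
  have "b \<in> {b. E a b \<in> X}" for a b
    by (rule total_induct[OF F])
      (use X bounded_clinear_vimage[OF bounded_clinear_tensor_right[OF E] X(1,2)] in auto)
  then have "range (\<lambda>(a, b). E a b) \<subseteq> X" by auto
  then show "x \<in> X" by (rule total_induct[OF hilbert_tensor_total[OF E] _ X(1,2)])
qed

section \<open>Infinite tensor products along a unit vector\<close>

lemma infinite_tensor_cinner:
  assumes "infinite_tensor \<Omega> T" "\<And>n. n \<ge> N \<Longrightarrow> f n = \<Omega>" "\<And>n. n \<ge> N \<Longrightarrow> g n = \<Omega>"
  shows "cinner (T f) (T g) = (\<Prod>n<N. cinner (f n) (g n))"
  using assms unfolding infinite_tensor_def by metis

text \<open>Comparing the defining formula for \<open>N = 0\<close> and \<open>N = 1\<close> shows that \<open>\<Omega>\<close> is a unit vector.\<close>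

lemma infinite_tensor_unit:
  assumes "infinite_tensor \<Omega> T"
  shows "cinner \<Omega> \<Omega> = 1" "norm (T (\<lambda>_. \<Omega>)) = 1"
proof -
  have c: "cinner (T (\<lambda>_. \<Omega>)) (T (\<lambda>_. \<Omega>)) = (\<Prod>n<N. cinner \<Omega> \<Omega>)" for N :: nat
    by (rule infinite_tensor_cinner[OF assms]) simp_all
  from c[of 0] c[of 1] show "cinner \<Omega> \<Omega> = 1" by simp
  from c[of 0] have "norm (T (\<lambda>_. \<Omega>)) = norm (1 :: complex)"
    by (intro norm_eq_if_cinner_eq) (simp add: cinner_complex_def)
  then show "norm (T (\<lambda>_. \<Omega>)) = 1" by simp
qed

lemma tail_seqs_decompose:
  assumes "f \<in> tail_seqs \<Omega>"
  shows "(\<lambda>n. f (Suc n)) \<in> tail_seqs \<Omega>" "f = case_nat (f 0) (\<lambda>n. f (Suc n))"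
proof -
  from assms obtain N where "\<And>n. n \<ge> N \<Longrightarrow> f n = \<Omega>" by (auto simp: tail_seqs_def)
  then have "\<forall>n\<ge>N. f (Suc n) = \<Omega>" by simp
  then show "(\<lambda>n. f (Suc n)) \<in> tail_seqs \<Omega>" unfolding tail_seqs_def by blast
qed (auto split: nat.split)

text \<open>Both sequences are constant from a common index on; prepending moves this index up by
  one, and the extra factor of the product is the inner product of the heads.\<close>

lemma infinite_tensor_case_nat:
  assumes T: "infinite_tensor \<Omega> T" and fg: "f \<in> tail_seqs \<Omega>" "g \<in> tail_seqs \<Omega>"
  shows "cinner (T (case_nat k f)) (T (case_nat l g)) = cinner k l * cinner (T f) (T g)"
proof -
  obtain N N' where "\<And>n. n \<ge> N \<Longrightarrow> f n = \<Omega>" "\<And>n. n \<ge> N' \<Longrightarrow> g n = \<Omega>"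
    using fg by (auto simp: tail_seqs_def)
  then have N: "\<forall>n\<ge>max N N'. f n = \<Omega> \<and> g n = \<Omega>" by auto
  then have "\<forall>n\<ge>Suc (max N N'). case_nat k f n = \<Omega> \<and> case_nat l g n = \<Omega>"
    by (auto split: nat.split)
  then have "cinner (T (case_nat k f)) (T (case_nat l g))
      = (\<Prod>n<Suc (max N N'). cinner (case_nat k f n) (case_nat l g n))"
    using T unfolding infinite_tensor_def by blast
  moreover have "cinner (T f) (T g) = (\<Prod>n<max N N'. cinner (f n) (g n))"
    using T N unfolding infinite_tensor_def by blast
  ultimately show ?thesis by (simp only: prod.lessThan_Suc_shift) simp
qed

lemma tensor_Cons:
  assumes T: "infinite_tensor \<Omega> T"
  shows bounded_clinear_tensor_Cons: "bounded_clinear (tensor_Cons \<Omega> T k)"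
    and tensor_Cons_apply: "f \<in> tail_seqs \<Omega> \<Longrightarrow> tensor_Cons \<Omega> T k (T f) = T (case_nat k f)"
proof -
  have tot: "closure (cspan (T ` tail_seqs \<Omega>)) = UNIV" using T by (simp add: infinite_tensor_def)
  have ex: "\<exists>S. bounded_clinear S \<and> (\<forall>f\<in>tail_seqs \<Omega>. S (T f) = T (case_nat k f))"
    by (rule bounded_clinear_total_ext[where c = "cinner k k", OF tot])
      (auto simp: infinite_tensor_case_nat[OF T])
  have "bounded_clinear (tensor_Cons \<Omega> T k) \<and> (\<forall>f\<in>tail_seqs \<Omega>. tensor_Cons \<Omega> T k (T f) = T (case_nat k f))"
    unfolding tensor_Cons_def
    by (intro conjI bounded_clinear_the[OF tot ex]) auto
  then show "bounded_clinear (tensor_Cons \<Omega> T k)"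
    "f \<in> tail_seqs \<Omega> \<Longrightarrow> tensor_Cons \<Omega> T k (T f) = T (case_nat k f)" by auto
qed

text \<open>This is the identification of \<open>\<K> \<otimes> \<K>\<^sup>\<infinity>\<close> with \<open>\<K>\<^sup>\<infinity>\<close>.\<close>

lemma hilbert_tensor_tensor_Cons:
  assumes T: "infinite_tensor \<Omega> T"
  shows "hilbert_tensor (tensor_Cons \<Omega> T)"
  unfolding hilbert_tensor_def
proof (intro conjI allI)
  have tot: "closure (cspan (T ` tail_seqs \<Omega>)) = UNIV" using T by (simp add: infinite_tensor_def)
  fix a b a' b'
  \<comment> \<open>First only one of the two infinite factors is arbitrary; conjugating and
    repeating the density argument frees the other.\<close>
  have eq: "cinner (tensor_Cons \<Omega> T a (T f)) (tensor_Cons \<Omega> T a' b) = cinner a a' * cinner (T f) b"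
    if f: "f \<in> tail_seqs \<Omega>" for f b
    by (rule bounded_clinear_eqI[OF tot bounded_clinear_compose[OF bounded_clinear_cinner
            bounded_clinear_tensor_Cons[OF T]] bounded_clinear_mult[OF bounded_clinear_cinner]])
      (use f in \<open>auto simp: tensor_Cons_apply[OF T] infinite_tensor_case_nat[OF T]\<close>)
  have "cinner (tensor_Cons \<Omega> T a' b') (tensor_Cons \<Omega> T a b) = cinner a' a * cinner b' b"
  proof (rule bounded_clinear_eqI[OF tot bounded_clinear_compose[OF bounded_clinear_cinner
            bounded_clinear_tensor_Cons[OF T]] bounded_clinear_mult[OF bounded_clinear_cinner]])
    show "cinner (tensor_Cons \<Omega> T a' b') (tensor_Cons \<Omega> T a x) = cinner a' a * cinner b' x"
      if "x \<in> T ` tail_seqs \<Omega>" for x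
      using that eq by (metis (no_types, lifting) cinner_commute complex_cnj_mult imageE)
  qed
  then show "cinner (tensor_Cons \<Omega> T a b) (tensor_Cons \<Omega> T a' b') = cinner a a' * cinner b b'"
    by (metis cinner_commute complex_cnj_mult)
  have "T ` tail_seqs \<Omega> \<subseteq> {tensor_Cons \<Omega> T a b |a b. True}"
  proof
    fix y assume "y \<in> T ` tail_seqs \<Omega>"
    then obtain f where "f \<in> tail_seqs \<Omega>" "y = T f" by blast
    then have "y = tensor_Cons \<Omega> T (f 0) (T (\<lambda>n. f (Suc n)))"
      using tail_seqs_decompose[of f \<Omega>] tensor_Cons_apply[OF T] by metis
    then show "y \<in> {tensor_Cons \<Omega> T a b |a b. True}" by blast
  qed
  then show "closure (cspan {tensor_Cons \<Omega> T a b |a b. True}) = UNIV"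
    by (rule total_mono[OF tot])
qed

lemma tensor_assoc_eq: "tensor_assoc HK HKK \<Omega> T z y = tensor_lift HK (\<lambda>h k. HKK h (tensor_Cons \<Omega> T k y)) z"
  by (simp add: tensor_assoc_def tensor_lift_def)

text \<open>For fixed \<open>y\<close> the prescribed values have inner products scaled by
  \<open>cinner y y\<close>, so the lift exists; the same computation with two different vectors
  \<open>y\<close>, \<open>y'\<close> gives the tensor product law.\<close>

lemma tensor_assoc:
  assumes HK: "hilbert_tensor HK" and HKK: "hilbert_tensor HKK" and T: "infinite_tensor \<Omega> T"
  shows tensor_assoc_apply: "tensor_assoc HK HKK \<Omega> T (HK h k) y = HKK h (tensor_Cons \<Omega> T k y)"
    and hilbert_tensor_tensor_assoc: "hilbert_tensor (tensor_assoc HK HKK \<Omega> T)"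
proof -
  note C = hilbert_tensor_tensor_Cons[OF T]
  have ip: "cinner (HKK h (tensor_Cons \<Omega> T k y)) (HKK h' (tensor_Cons \<Omega> T k' y'))
      = cinner y y' * (cinner h h' * cinner k k')" for h k y h' k' y'
    by (simp add: hilbert_tensor_cinner[OF HKK] hilbert_tensor_cinner[OF C])
  note lift = tensor_lift[OF HK ip]
  show app: "tensor_assoc HK HKK \<Omega> T (HK h k) y = HKK h (tensor_Cons \<Omega> T k y)" for h k y
    unfolding tensor_assoc_eq by (rule lift)
  show "hilbert_tensor (tensor_assoc HK HKK \<Omega> T)"
    unfolding hilbert_tensor_def
  proof (intro conjI allI)
    fix z z' y y'
    have "cinner (tensor_assoc HK HKK \<Omega> T z y) (tensor_assoc HK HKK \<Omega> T z' y') = cinner y y' * cinner z z'"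
      unfolding tensor_assoc_eq
      by (rule tensor_form_eqI[OF HK lift(1) lift(1)]) (simp add: lift(2) ip)
    then show "cinner (tensor_assoc HK HKK \<Omega> T z y) (tensor_assoc HK HKK \<Omega> T z' y') = cinner z z' * cinner y y'"
      by simp
    show "closure (cspan {tensor_assoc HK HKK \<Omega> T z y |z y. True}) = UNIV"
      by (rule total_mono[OF tensor_total_right[OF HKK hilbert_tensor_total[OF C]]])
        (use app in \<open>auto; metis\<close>)
  qed
qed

subsection \<open>Mixed tensor powers\<close>

lemma list_cinner_Nil [simp]: "list_cinner [] [] = 1" "list_cinner [] (y # ys) = 0" "list_cinner (x # xs) [] = 0"
  by (simp_all add: list_cinner_def)

lemma list_cinner_Cons [simp]: "list_cinner (x # xs) (y # ys) = cinner x y * list_cinner xs ys"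
  by (simp add: list_cinner_def prod.lessThan_Suc_shift del: prod.lessThan_Suc)

lemma list_cinner_length: "length xs \<noteq> length ys \<Longrightarrow> list_cinner xs ys = 0"
  by (simp add: list_cinner_def)

lemma list_cinner_append:
  "length xs = length ys \<Longrightarrow> list_cinner (xs @ xs') (ys @ ys') = list_cinner xs ys * list_cinner xs' ys'"
  by (induction xs ys rule: list_induct2) simp_all

text \<open>Here the prefixes may differ in length; then both sides vanish.\<close>

lemma list_cinner_append_right:
  assumes "length xs' = length ys'"
  shows "list_cinner (xs @ xs') (ys @ ys') = list_cinner xs ys * list_cinner xs' ys'"
proof (cases "length xs = length ys")
  case False
  then show ?thesis using assms by (simp add: list_cinner_length)
qed (simp add: list_cinner_append)

lemma list_cinner_replicate: "cinner x x = 1 \<Longrightarrow> list_cinner (replicate n x) (replicate n x) = 1"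
  by (induction n) simp_all

lemma mixed_tensor_cinner:
  "mixed_tensor M \<Longrightarrow> cinner (M h ps ks) (M h' ps' ks') = cinner h h' * list_cinner ps ps' * list_cinner ks ks'"
  by (simp add: mixed_tensor_def)

lemma mixed_tensor_total:
  assumes "mixed_tensor M" shows "closure (cspan (range (\<lambda>(h, ps, ks). M h ps ks))) = UNIV"
proof -
  have "range (\<lambda>(h, ps, ks). M h ps ks) = {M h ps ks |h ps ks. True}" by (auto simp: image_def)
  then show ?thesis using assms by (simp add: mixed_tensor_def)
qed

lemma mixed_eqI:
  assumes "mixed_tensor M" "bounded_clinear S" "bounded_clinear T" "\<And>h ps ks. S (M h ps ks) = T (M h ps ks)"
  shows "S x = T x"
  by (rule bounded_clinear_eqI[OF mixed_tensor_total[OF assms(1)] assms(2,3)]) (use assms(4) in auto)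

lemma mixed_cinner_eqI:
  assumes "mixed_tensor M" "\<And>h ps ks. cinner (M h ps ks) x = cinner (M h ps ks) y"
  shows "x = y"
  by (rule total_cinner_eqI[OF mixed_tensor_total[OF assms(1)]]) (use assms(2) in auto)

text \<open>Since \<open>P\<close> depends only on lengths, it selects some of the orthogonal
  summands; the operator is isometric on them and zero on the others.\<close>

lemma mixed_the:
  assumes M: "mixed_tensor M"
    and ip: "\<And>h ps ks h' ps' ks'. P ps ks \<Longrightarrow> P ps' ks' \<Longrightarrow>
      cinner (g h ps ks) (g h' ps' ks') = cinner h h' * list_cinner ps ps' * list_cinner ks ks'"
    and P: "\<And>ps ks ps' ks'. P ps ks \<Longrightarrow> length ps' = length ps \<Longrightarrow> length ks' = length ks \<Longrightarrow> P ps' ks'"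
  defines "S \<equiv> THE S. bounded_clinear S \<and> (\<forall>h ps ks. S (M h ps ks) = (if P ps ks then g h ps ks else 0))"
  shows "bounded_clinear S" "S (M h ps ks) = (if P ps ks then g h ps ks else 0)"
proof -
  have ex: "\<exists>S. bounded_clinear S \<and> (\<forall>x. S (case x of (h, ps, ks) \<Rightarrow> M h ps ks)
      = (if (case x of (h, ps, ks) \<Rightarrow> P ps ks) then (case x of (h, ps, ks) \<Rightarrow> g h ps ks) else 0))"
  proof (rule bounded_clinear_total_ext_partial[OF mixed_tensor_total[OF M]])
    fix x y :: "'a \<times> 'b list \<times> 'c list"
    assume "case x of (h, ps, ks) \<Rightarrow> P ps ks" "case y of (h, ps, ks) \<Rightarrow> P ps ks"
    then show "cinner (case x of (h, ps, ks) \<Rightarrow> g h ps ks) (case y of (h, ps, ks) \<Rightarrow> g h ps ks)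
        = cinner (case x of (h, ps, ks) \<Rightarrow> M h ps ks) (case y of (h, ps, ks) \<Rightarrow> M h ps ks)"
      by (cases x; cases y) (simp add: ip mixed_tensor_cinner[OF M])
  next
    fix x y :: "'a \<times> 'b list \<times> 'c list"
    assume "case x of (h, ps, ks) \<Rightarrow> P ps ks" "\<not> (case y of (h, ps, ks) \<Rightarrow> P ps ks)"
    then show "cinner (case x of (h, ps, ks) \<Rightarrow> M h ps ks) (case y of (h, ps, ks) \<Rightarrow> M h ps ks) = 0"
      using P by (cases x; cases y) (auto simp: mixed_tensor_cinner[OF M] list_cinner_def)
  qed
  then have ex': "\<exists>S. bounded_clinear S \<and> (\<forall>h ps ks. S (M h ps ks) = (if P ps ks then g h ps ks else 0))"
    by auto
  have "bounded_clinear S" "\<forall>h ps ks. S (M h ps ks) = (if P ps ks then g h ps ks else 0)"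
    unfolding S_def by (rule bounded_clinear_the[OF mixed_tensor_total[OF M] ex']; auto)+
  then show "bounded_clinear S" "S (M h ps ks) = (if P ps ks then g h ps ks else 0)" by auto
qed

lemma mixed_the_all:
  assumes M: "mixed_tensor M"
    and ip: "\<And>h ps ks h' ps' ks'.
      cinner (g h ps ks) (g h' ps' ks') = cinner h h' * list_cinner ps ps' * list_cinner ks ks'"
  defines "S \<equiv> THE S. bounded_clinear S \<and> (\<forall>h ps ks. S (M h ps ks) = g h ps ks)"
  shows "bounded_clinear S" "S (M h ps ks) = g h ps ks"
  using mixed_the[OF M, of "\<lambda>_ _. True" g] ip unfolding S_def by simp_all

text \<open>Equal lengths matter: padded tensors of different lengths need not be orthogonal, which
  is why each embedding treats a single length.\<close>

lemma infinite_tensor_pad: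
  assumes T: "infinite_tensor \<Omega> T" and len: "length ks = length ks'"
  shows "cinner (tensor_pad \<Omega> T ks) (tensor_pad \<Omega> T ks') = list_cinner ks ks'"
proof -
  have "cinner (tensor_pad \<Omega> T ks) (tensor_pad \<Omega> T ks')
    = (\<Prod>n<length ks. cinner (if n < length ks then ks ! n else \<Omega>) (if n < length ks' then ks' ! n else \<Omega>))"
    unfolding tensor_pad_def by (rule infinite_tensor_cinner[OF T]) (simp_all add: len)
  then show ?thesis using len by (simp add: list_cinner_def)
qed

lemma tail_seqs_pad: "(\<lambda>n. if n < length ks then ks ! n else \<Omega>) \<in> tail_seqs \<Omega>"
  unfolding tail_seqs_def by (auto intro!: exI[of _ "length ks"])

lemma tensor_pad_Cons:
  assumes T: "infinite_tensor \<Omega> T"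
  shows "tensor_Cons \<Omega> T k (tensor_pad \<Omega> T ks) = tensor_pad \<Omega> T (k # ks)"
proof -
  have "case_nat k (\<lambda>n. if n < length ks then ks ! n else \<Omega>)
      = (\<lambda>n. if n < length (k # ks) then (k # ks) ! n else \<Omega>)"
    by (rule ext) (simp split: nat.split)
  then show ?thesis unfolding tensor_pad_def by (simp add: tensor_Cons_apply[OF T tail_seqs_pad])
qed

lemma tail_seqs_eq_pad:
  assumes "f \<in> tail_seqs \<Omega>" shows "\<exists>ks. T f = tensor_pad \<Omega> T ks"
proof -
  from assms obtain N where "\<And>n. n \<ge> N \<Longrightarrow> f n = \<Omega>" by (auto simp: tail_seqs_def)
  then have "f = (\<lambda>n. if n < length (map f [0..<N]) then map f [0..<N] ! n else \<Omega>)" by auto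
  then show ?thesis unfolding tensor_pad_def by metis
qed

section \<open>The intertwiner of the tensor product dilation\<close>

text \<open>About \<open>wt\<close> only boundedness and the limit formula are assumed; its isometry
  and range properties on the dilation space are derived.\<close>

locale tensor_dilation =
  fixes A :: "'i \<Rightarrow> 'h :: complex_hilbert \<Rightarrow> 'h"
    and \<omega> :: "'i \<Rightarrow> complex"
    and \<Omega>H :: 'h
    and \<epsilon> :: "'i \<Rightarrow> 'p :: complex_hilbert" and \<Omega>P :: 'p
    and \<Omega>K :: "'k :: complex_hilbert"
    and HP :: "'h \<Rightarrow> 'p \<Rightarrow> 'hp :: complex_hilbert"
    and HK :: "'h \<Rightarrow> 'k \<Rightarrow> 'hk :: complex_hilbert"
    and TK :: "(nat \<Rightarrow> 'k) \<Rightarrow> 'kk :: complex_hilbert"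
    and TP :: "(nat \<Rightarrow> 'p) \<Rightarrow> 'pp :: complex_hilbert"
    and HKK :: "'h \<Rightarrow> 'kk \<Rightarrow> 'hkk :: complex_hilbert"
    and HPP :: "'h \<Rightarrow> 'pp \<Rightarrow> 'hpp :: complex_hilbert"
    and M :: "'h \<Rightarrow> 'p list \<Rightarrow> 'k list \<Rightarrow> 'f :: complex_hilbert"
    and u :: "'hp \<Rightarrow> 'hk"
    and wt :: "'hkk \<Rightarrow> 'hpp"
  assumes A: "\<And>i. bounded_clinear (A i)" "coisometric A" "ergodic A"
    and \<Omega>H: "norm \<Omega>H = 1"
    and eigen: "\<And>i. hadj (A i) \<Omega>H = cnj (\<omega> i) *\<^sub>C \<Omega>H"
    and HP: "hilbert_tensor HP" and HK: "hilbert_tensor HK"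
    and TK: "infinite_tensor \<Omega>K TK" and TP: "infinite_tensor \<Omega>P TP"
    and HKK: "hilbert_tensor HKK" and HPP: "hilbert_tensor HPP"
    and M: "mixed_tensor M"
    and \<epsilon>: "orthonormal_basis \<epsilon>"
    and \<Omega>P: "((\<lambda>i. cnj (\<omega> i) *\<^sub>C \<epsilon> i) has_sum \<Omega>P) UNIV"
    and u: "isometry_on u UNIV UNIV"
    and hadj_u: "\<And>h. ((\<lambda>i. HP (hadj (A i) h) (\<epsilon> i)) has_sum hadj u (HK h \<Omega>K)) UNIV"
    and wt: "bounded_clinear wt"
    and wt_limit: "\<And>m \<xi>. \<xi> \<in> finite_power M m \<Longrightarrow>
         (\<lambda>n. embed_P M HPP \<Omega>P TP n (u_adj_prod HP HK M u n (append_vac M \<Omega>K (n - m) \<xi>)))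
           \<longlonglongrightarrow> wt (embed_K M HKK \<Omega>K TK m \<xi>)"
begin

abbreviation "t \<equiv> dilation_t HP HK HKK \<Omega>K TK \<epsilon> u"
abbreviation "s i \<equiv> tensor_Cons \<Omega>P TP (\<epsilon> i)"
abbreviation "\<iota> h \<equiv> HKK h (TK (\<lambda>_. \<Omega>K))"
abbreviation "assoc \<equiv> tensor_assoc HK HKK \<Omega>K TK"

section \<open>The operators of the tensor product dilation\<close>

lemma u_clinear: "bounded_clinear u"
  by (rule bounded_clinear_isometry[OF u])

lemma u_cinner: "cinner (u x) (u y) = cinner x y"
  by (rule isometry_on_cinner[OF u]) (simp_all add: cvec.subspace_def)

lemma \<epsilon>_cinner: "cinner (\<epsilon> i) (\<epsilon> j) = (if i = j then 1 else 0)"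
  using \<epsilon> by (simp add: orthonormal_basis_def)

text \<open>The range of \<open>u\<close> contains these vectors because \<open>hadj u\<close>
  preserves their norm: by orthonormality of \<open>\<epsilon>\<close> the squared norm of the image
  is the sum of the numbers \<open>cinner h (A i (hadj (A i) h))\<close>, which is
  \<open>cinner h h\<close> by coisometry.\<close>

lemma u_hadj_vacuum: "u (hadj u (HK h \<Omega>K)) = HK h \<Omega>K"
proof (rule isometry_range_if_norm_hadj[OF u_clinear u_cinner])
  define v where "v = hadj u (HK h \<Omega>K)"
  have 1: "cinner (HP (hadj (A i) h) (\<epsilon> i)) v = cinner h (A i (hadj (A i) h))" for i
    unfolding v_def
    by (rule cinner_has_sum_single[OF hadj_u, where i = i])
      (simp add: hilbert_tensor_cinner[OF HP] \<epsilon>_cinner cinner_hadj_left[OF A(1)])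
  have "cinner v (HP (hadj (A i) h) (\<epsilon> i)) = cinner h (A i (hadj (A i) h))" for i
    using 1[of i] cinner_hadj_left[OF A(1)] by (metis cinner_commute)
  moreover have "((\<lambda>i. cinner v (HP (hadj (A i) h) (\<epsilon> i))) has_sum cinner v v) UNIV"
    using bounded_clinear_has_sum[OF bounded_clinear_cinner hadj_u] by (simp add: v_def)
  moreover have "((\<lambda>i. cinner h (A i (hadj (A i) h))) has_sum cinner h h) UNIV"
    using A(2) by (intro bounded_clinear_has_sum[OF bounded_clinear_cinner]) (simp add: coisometric_def)
  ultimately have "cinner v v = cinner h h" by (auto intro: has_sum_unique)
  then show "cinner (hadj u (HK h \<Omega>K)) (hadj u (HK h \<Omega>K)) = cinner (HK h \<Omega>K) (HK h \<Omega>K)"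
    by (simp add: v_def hilbert_tensor_cinner[OF HK] infinite_tensor_unit[OF TK])
qed

text \<open>The eigenvalue of \<open>hadj (A i)\<close> at \<open>\<Omega>H\<close> moves to the
  second tensor factor, where the sum becomes the expansion of \<open>\<Omega>P\<close>.\<close>

lemma hadj_u_vacuum: "hadj u (HK \<Omega>H \<Omega>K) = HP \<Omega>H \<Omega>P"
proof -
  have "HP (hadj (A i) \<Omega>H) (\<epsilon> i) = HP \<Omega>H (cnj (\<omega> i) *\<^sub>C \<epsilon> i)" for i
    by (simp add: eigen bounded_clinear_scaleC[OF bounded_clinear_tensor_left[OF HP]]
        bounded_clinear_scaleC[OF bounded_clinear_tensor_right[OF HP]])
  then have "((\<lambda>i. HP \<Omega>H (cnj (\<omega> i) *\<^sub>C \<epsilon> i)) has_sum hadj u (HK \<Omega>H \<Omega>K)) UNIV"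
    using hadj_u[of \<Omega>H] by simp
  then show ?thesis
    using bounded_clinear_has_sum[OF bounded_clinear_tensor_right[OF HP] \<Omega>P] has_sum_unique by blast
qed

lemma assoc: "hilbert_tensor assoc" "assoc (HK h k) y = HKK h (tensor_Cons \<Omega>K TK k y)"
  by (rule hilbert_tensor_tensor_assoc[OF HK HKK TK] tensor_assoc_apply[OF HK HKK TK])+

lemma t_eq: "t i = tensor_lift HKK (\<lambda>h y. assoc (u (HP h (\<epsilon> i))) y)"
  by (simp add: dilation_t_def tensor_lift_def)

lemma t_ip: "cinner (assoc (u (HP h (\<epsilon> i))) y) (assoc (u (HP h' (\<epsilon> j))) y')
    = cinner (\<epsilon> i) (\<epsilon> j) * (cinner h h' * cinner y y')"
  by (simp add: hilbert_tensor_cinner[OF assoc(1)] u_cinner hilbert_tensor_cinner[OF HP])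

lemma t_clinear: "bounded_clinear (t i)"
  and t_apply: "t i (HKK h y) = assoc (u (HP h (\<epsilon> i))) y"
  unfolding t_eq by (rule tensor_lift[OF HKK t_ip])+

lemma t_cinner: "cinner (t i x) (t j y) = (if i = j then cinner x y else 0)"
proof -
  have "cinner (t i x) (t j y) = cinner (\<epsilon> i) (\<epsilon> j) * cinner x y"
    by (rule tensor_form_eqI[OF HKK t_clinear t_clinear]) (simp add: t_apply t_ip)
  then show ?thesis by (simp add: \<epsilon>_cinner)
qed

lemma s_hilbert_tensor: "hilbert_tensor (tensor_Cons \<Omega>P TP)"
  by (rule hilbert_tensor_tensor_Cons[OF TP])

lemma s_clinear: "bounded_clinear (s i)"
  by (rule bounded_clinear_tensor_Cons[OF TP])

lemma s_cinner: "cinner (s i x) (s j y) = (if i = j then cinner x y else 0)"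
  by (simp add: hilbert_tensor_cinner[OF s_hilbert_tensor] \<epsilon>_cinner)

definition "S i = tensor_lift HPP (\<lambda>h y. HPP h (s i y))"

lemma S_ip: "cinner (HPP h (s i y)) (HPP h' (s j y')) = cinner (\<epsilon> i) (\<epsilon> j) * (cinner h h' * cinner y y')"
  by (simp add: hilbert_tensor_cinner[OF HPP] hilbert_tensor_cinner[OF s_hilbert_tensor])

lemma S_clinear: "bounded_clinear (S i)"
  and S_apply: "S i (HPP h y) = HPP h (s i y)"
  unfolding S_def by (rule tensor_lift[OF HPP S_ip])+

lemma S_cinner: "cinner (S i x) (S j y) = (if i = j then cinner x y else 0)"
proof -
  have "cinner (S i x) (S j y) = cinner (\<epsilon> i) (\<epsilon> j) * cinner x y"
    by (rule tensor_form_eqI[OF HPP S_clinear S_clinear]) (simp add: S_apply S_ip)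
  then show ?thesis by (simp add: \<epsilon>_cinner)
qed

text \<open>Split off the first vacuum factor, write \<open>HK h \<Omega>K\<close> as
  \<open>u (hadj u (HK h \<Omega>K))\<close> and expand the inner vector over the basis
  \<open>\<epsilon>\<close>.\<close>

lemma \<iota>_has_sum: "((\<lambda>i. t i (\<iota> (hadj (A i) h))) has_sum \<iota> h) UNIV"
proof -
  have "((\<lambda>i. assoc (u (HP (hadj (A i) h) (\<epsilon> i))) (TK (\<lambda>_. \<Omega>K)))
      has_sum assoc (u (hadj u (HK h \<Omega>K))) (TK (\<lambda>_. \<Omega>K))) UNIV"
    by (intro bounded_clinear_has_sum[OF bounded_clinear_tensor_left[OF assoc(1)]]
        bounded_clinear_has_sum[OF u_clinear] hadj_u)
  moreover have "case_nat \<Omega>K (\<lambda>_. \<Omega>K) = (\<lambda>_. \<Omega>K)" by (rule ext) (simp split: nat.split)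
  then have "tensor_Cons \<Omega>K TK \<Omega>K (TK (\<lambda>_. \<Omega>K)) = TK (\<lambda>_. \<Omega>K)"
    by (simp add: tensor_Cons_apply[OF TK] tail_seqs_def)
  ultimately show ?thesis by (simp add: t_apply u_hadj_vacuum assoc(2))
qed

subsection \<open>The infinite product formula\<close>

abbreviation "insK ps ks \<equiv> insert_HK HK M ps ks"
text \<open>The counterpart of \<open>insK\<close>: the new \<P>-factor stands at the end of the
  \<P>-block, the place where \<open>slot\<close> turns it into the first \<K>-factor.\<close>

definition "insP ps ks = tensor_lift HP (\<lambda>h p. M h (ps @ [p]) ks)"

lemma insK_eq: "insK ps ks = tensor_lift HK (\<lambda>h k. M h ps (k # ks))"
  by (simp add: insert_HK_def tensor_lift_def)

lemma insK_ip: "cinner (M h ps (k # ks)) (M h' ps' (k' # ks'))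
    = (list_cinner ps ps' * list_cinner ks ks') * (cinner h h' * cinner k k')"
  by (simp add: mixed_tensor_cinner[OF M])

lemma insP_ip: "cinner (M h (ps @ [p]) ks) (M h' (ps' @ [p']) ks')
    = (list_cinner ps ps' * list_cinner ks ks') * (cinner h h' * cinner p p')"
  by (simp add: mixed_tensor_cinner[OF M] list_cinner_append_right)

lemma insK_clinear: "bounded_clinear (insK ps ks)"
  and insK_apply: "insK ps ks (HK h k) = M h ps (k # ks)"
  unfolding insK_eq by (rule tensor_lift[OF HK insK_ip])+

lemma insP_clinear: "bounded_clinear (insP ps ks)"
  and insP_apply: "insP ps ks (HP h p) = M h (ps @ [p]) ks"
  unfolding insP_def by (rule tensor_lift[OF HP insP_ip])+

lemma insK_cinner: "cinner (insK ps ks x) (insK ps' ks' y) = (list_cinner ps ps' * list_cinner ks ks') * cinner x y"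
  by (rule tensor_form_eqI[OF HK insK_clinear insK_clinear]) (simp add: insK_apply insK_ip)

lemma insP_cinner: "cinner (insP ps ks x) (insP ps' ks' y) = (list_cinner ps ps' * list_cinner ks ks') * cinner x y"
  by (rule tensor_form_eqI[OF HP insP_clinear insP_clinear]) (simp add: insP_apply insP_ip)

lemma insP_orth:
  assumes "length ps' \<noteq> Suc (length ps)" shows "cinner (M h ps' ks') (insP ps ks z) = 0"
proof -
  have "cinner (M h ps' ks') (insP ps ks z) = cinner 0 z"
    by (rule tensor_eqI[OF HP bounded_clinear_compose[OF bounded_clinear_cinner insP_clinear] bounded_clinear_cinner])
      (use assms in \<open>simp add: insP_apply mixed_tensor_cinner[OF M] list_cinner_length\<close>)
  then show ?thesis by simp
qed

lemma insK_orth: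
  assumes "ks = [] \<or> length ps \<noteq> length ps'" shows "cinner (M h ps ks) (insK ps' ks' z) = 0"
proof -
  have "cinner (M h ps ks) (insK ps' ks' z) = cinner 0 z"
    by (rule tensor_eqI[OF HK bounded_clinear_compose[OF bounded_clinear_cinner insK_clinear] bounded_clinear_cinner])
      (use assms in \<open>auto simp add: insK_apply mixed_tensor_cinner[OF M] list_cinner_length\<close>)
  then show ?thesis by simp
qed

text \<open>The index is shifted: the adjoint of \<open>slot n\<close> acts on tensors that already
  have \<open>n\<close> \<P>-factors and produces the next one.\<close>

abbreviation "slot n \<equiv> u_slot HP HK M u (Suc n)"

lemma slot_ip:
  assumes "length ps = Suc n" "length ps' = Suc n"
  shows "cinner (insK (butlast ps) ks (u (HP h (last ps)))) (insK (butlast ps') ks' (u (HP h' (last ps'))))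
    = cinner h h' * list_cinner ps ps' * list_cinner ks ks'"
proof -
  have "ps = butlast ps @ [last ps]" "ps' = butlast ps' @ [last ps']"
    using assms by (metis append_butlast_last_id length_0_conv nat.distinct(1))+
  then have "list_cinner ps ps' = list_cinner (butlast ps) (butlast ps') * cinner (last ps) (last ps')"
    using list_cinner_append_right[of "[last ps]" "[last ps']" "butlast ps" "butlast ps'"] by simp
  then show ?thesis by (simp add: insK_cinner u_cinner hilbert_tensor_cinner[OF HP])
qed

lemma slot_eq: "slot n = (THE S. bounded_clinear S \<and> (\<forall>h ps ks. S (M h ps ks) =
    (if length ps = Suc n then insK (butlast ps) ks (u (HP h (last ps))) else 0)))"
proof -
  have "(\<forall>h ps p ks. length (ps @ [p]) = Suc n \<longrightarrow> S (M h (ps @ [p]) ks) = insK ps ks (u (HP h p))) \<and>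
      (\<forall>h ps ks. length ps \<noteq> Suc n \<longrightarrow> S (M h ps ks) = 0)
    \<longleftrightarrow> (\<forall>h ps ks. S (M h ps ks) =
      (if length ps = Suc n then insK (butlast ps) ks (u (HP h (last ps))) else 0))" (is "?L \<longleftrightarrow> ?R") for S :: "'f \<Rightarrow> 'f"
  proof
    assume L: ?L
    show ?R
    proof (intro allI)
      fix h ps ks
      show "S (M h ps ks) = (if length ps = Suc n then insK (butlast ps) ks (u (HP h (last ps))) else 0)"
        using L by (cases ps rule: rev_cases) auto
    qed
  qed auto
  then show ?thesis unfolding u_slot_def by simp
qed

lemma slot_clinear: "bounded_clinear (slot n)"
  and slot_apply: "slot n (M h ps ks) = (if length ps = Suc n then insK (butlast ps) ks (u (HP h (last ps))) else 0)"
  unfolding slot_eq by (rule mixed_the[OF M]; simp add: slot_ip)+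

lemma hadj_slot_insK:
  assumes n: "length ps = n"
  shows "hadj (slot n) (insK ps ks z) = insP ps ks (hadj u z)"
proof (rule mixed_cinner_eqI[OF M])
  fix h' ps' ks'
  show "cinner (M h' ps' ks') (hadj (slot n) (insK ps ks z)) = cinner (M h' ps' ks') (insP ps ks (hadj u z))"
  proof (cases "length ps' = Suc n")
    case True
    then obtain qs q where q: "ps' = qs @ [q]" by (cases ps' rule: rev_cases) auto
    have "cinner (M h' ps' ks') (insP ps ks (hadj u z)) = list_cinner qs ps * list_cinner ks' ks * cinner (HP h' q) (hadj u z)"
      by (simp add: q insP_cinner flip: insP_apply)
    then show ?thesis using True
      by (simp add: q cinner_hadj_right[OF slot_clinear] slot_apply insK_cinner cinner_hadj_right[OF u_clinear])
  qed (simp add: cinner_hadj_right[OF slot_clinear] slot_apply insP_orth n)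
qed

text \<open>The range of \<open>slot n\<close> lies in the summands with \<open>n\<close>
  \<P>-factors and at least one \<K>-factor; its adjoint kills all the others.\<close>

lemma hadj_slot_zero:
  assumes n: "ks = [] \<or> length ps \<noteq> n"
  shows "hadj (slot n) (M h ps ks) = 0"
proof (rule mixed_cinner_eqI[OF M])
  fix h' ps' ks'
  have "cinner (insK (butlast ps') ks' z) (M h ps ks) = 0" if "length ps' = Suc n" for z
    using insK_orth[of ks ps "butlast ps'" h ks' z] that n by (subst cinner_commute) auto
  then show "cinner (M h' ps' ks') (hadj (slot n) (M h ps ks)) = cinner (M h' ps' ks') 0"
    by (simp add: cinner_hadj_right[OF slot_clinear] slot_apply)
qed

section \<open>Prepending a basis vector and the product formula\<close>

definition "C i = (THE S. bounded_clinear S \<and> (\<forall>h ps ks. S (M h ps ks) = M h (\<epsilon> i # ps) ks))"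

lemma C_clinear: "bounded_clinear (C i)"
  and C_apply: "C i (M h ps ks) = M h (\<epsilon> i # ps) ks"
  unfolding C_def
  by (rule mixed_the_all[OF M]; simp add: mixed_tensor_cinner[OF M] \<epsilon>_cinner)+

lemma C_insP: "C i (insP ps ks z) = insP (\<epsilon> i # ps) ks z"
  by (rule tensor_eqI[OF HP bounded_clinear_compose[OF C_clinear insP_clinear] insP_clinear])
    (simp add: insP_apply C_apply)

text \<open>\<open>C i\<close> acts at the front of the \<P>-block and \<open>slot\<close> at its
  end, so they commute up to the shift of the slot number by one.\<close>

lemma hadj_slot_C: "hadj (slot (Suc n)) (C i y) = C i (hadj (slot n) y)"
proof (rule mixed_eqI[OF M bounded_clinear_compose[OF bounded_clinear_hadj[OF slot_clinear] C_clinear]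
      bounded_clinear_compose[OF C_clinear bounded_clinear_hadj[OF slot_clinear]]])
  fix h ps ks
  show "hadj (slot (Suc n)) (C i (M h ps ks)) = C i (hadj (slot n) (M h ps ks))"
  proof (cases "ks = [] \<or> length ps \<noteq> n")
    case True
    then have "ks = [] \<or> length (\<epsilon> i # ps) \<noteq> Suc n" by simp
    then show ?thesis
      using True by (simp only: C_apply hadj_slot_zero bounded_clinear_zero[OF C_clinear])
  next
    case False
    then obtain k ks' where k: "ks = k # ks'" "length ps = n" by (cases ks) auto
    have "hadj (slot (Suc n)) (insK (\<epsilon> i # ps) ks' (HK h k)) = C i (hadj (slot n) (insK ps ks' (HK h k)))"
      using k by (simp add: hadj_slot_insK C_insP)
    then show ?thesis by (simp add: insK_apply C_apply k)
  qed
qed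

text \<open>If the first step turns \<open>y'\<close> into \<open>C i y\<close>, the remaining
  \<open>n\<close> steps are those for \<open>y\<close>, carried through \<open>C i\<close> one at a
  time.\<close>

lemma u_adj_prod_C:
  assumes "hadj (slot 0) y' = C i y"
  shows "u_adj_prod HP HK M u (Suc n) y' = C i (u_adj_prod HP HK M u n y)"
  by (induction n) (simp_all add: assms hadj_slot_C)

lemma append_vac_clinear: "bounded_clinear (append_vac M \<Omega>K r)"
  and append_vac_apply: "append_vac M \<Omega>K r (M h ps ks) = M h ps (ks @ replicate r \<Omega>K)"
  unfolding append_vac_def
  by (rule mixed_the_all[OF M]; simp add: mixed_tensor_cinner[OF M] list_cinner_append_right
      list_cinner_replicate infinite_tensor_unit[OF TK])+

lemma append_vac_insK: "append_vac M \<Omega>K r (insK ps ks z) = insK ps (ks @ replicate r \<Omega>K) z"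
  by (rule tensor_eqI[OF HK bounded_clinear_compose[OF append_vac_clinear insK_clinear] insK_clinear])
    (simp add: insK_apply append_vac_apply)

abbreviation "embK \<equiv> embed_K M HKK \<Omega>K TK"
abbreviation "embP \<equiv> embed_P M HPP \<Omega>P TP"

lemma embK_clinear: "bounded_clinear (embK m)"
  and embK_apply: "embK m (M h ps ks) = (if ps = [] \<and> length ks = m then HKK h (tensor_pad \<Omega>K TK ks) else 0)"
  unfolding embed_K_def
  by (rule mixed_the[OF M, of "\<lambda>ps ks. ps = [] \<and> length ks = m"];
      auto simp: hilbert_tensor_cinner[OF HKK] infinite_tensor_pad[OF TK])+

lemma embP_clinear: "bounded_clinear (embP n)"
  and embP_apply: "embP n (M h ps ks) = (if ks = [] \<and> length ps = n then HPP h (tensor_pad \<Omega>P TP ps) else 0)"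
  unfolding embed_P_def
  by (rule mixed_the[OF M, of "\<lambda>ps ks. ks = [] \<and> length ps = n"];
      auto simp: hilbert_tensor_cinner[OF HPP] infinite_tensor_pad[OF TP])+

text \<open>Needed for arbitrary \<open>z\<close>, since the vectors
  \<open>u (HP h (\<epsilon> i))\<close> are in general not elementary tensors.\<close>

lemma embK_insK:
  assumes "length ks = m"
  shows "embK (Suc m) (insK [] ks z) = assoc z (tensor_pad \<Omega>K TK ks)"
  by (rule tensor_eqI[OF HK bounded_clinear_compose[OF embK_clinear insK_clinear]
        bounded_clinear_tensor_left[OF assoc(1)]])
    (simp add: insK_apply embK_apply assms assoc(2) tensor_pad_Cons[OF TK])

lemma embP_C: "embP (Suc n) (C i z) = S i (embP n z)"
  by (rule mixed_eqI[OF M bounded_clinear_compose[OF embP_clinear C_clinear]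
        bounded_clinear_compose[OF S_clinear embP_clinear]])
    (simp add: C_apply embP_apply S_apply tensor_pad_Cons[OF TP] bounded_clinear_zero[OF S_clinear])

lemma finite_power_insK:
  assumes "length ks = m" shows "insK [] ks z \<in> finite_power M (Suc m)"
proof -
  have sub: "cvec.subspace (finite_power M (Suc m))" "closed (finite_power M (Suc m))"
    unfolding finite_power_def by (intro csubspace_closure cvec.subspace_span closed_closure)+
  have "M h [] (k # ks) \<in> finite_power M (Suc m)" for h k
    unfolding finite_power_def using assms
    by (intro subsetD[OF closure_subset] cvec.span_base CollectI exI[of _ h] exI[of _ "k # ks"]) simp
  then have X: "range (\<lambda>(h, k). HK h k) \<subseteq> {z. insK [] ks z \<in> finite_power M (Suc m)}"
    by (auto simp: insK_apply)
  have "z \<in> {z. insK [] ks z \<in> finite_power M (Suc m)}"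
    by (rule total_induct[OF hilbert_tensor_total[OF HK] X bounded_clinear_vimage[OF insK_clinear sub(2,1)]])
  then show ?thesis by simp
qed

lemma finite_power_base: "length ks = m \<Longrightarrow> M h [] ks \<in> finite_power M m"
  unfolding finite_power_def by (intro subsetD[OF closure_subset] cvec.span_base) auto

text \<open>Applying \<open>t i\<close> prepends the factor \<open>u (h \<otimes> \<epsilon> i)\<close>, which the first step of the product
  formula turns back into \<open>h \<otimes> \<epsilon> i\<close>; the remaining steps do not see the factor \<open>\<epsilon> i\<close>.\<close>

lemma wt_t_pad: "wt (t i (HKK h (tensor_pad \<Omega>K TK ks))) = S i (wt (HKK h (tensor_pad \<Omega>K TK ks)))"
proof -
  define m where "m = length ks"
  define a where "a n = embP n (u_adj_prod HP HK M u n (append_vac M \<Omega>K (n - m) (M h [] ks)))" for n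
  define b where "b n = embP n (u_adj_prod HP HK M u n
    (append_vac M \<Omega>K (n - Suc m) (insK [] ks (u (HP h (\<epsilon> i))))))" for n
  have "a \<longlonglongrightarrow> wt (embK m (M h [] ks))"
    unfolding a_def by (rule wt_limit[OF finite_power_base]) (simp add: m_def)
  then have "(\<lambda>n. S i (a n)) \<longlonglongrightarrow> S i (wt (HKK h (tensor_pad \<Omega>K TK ks)))"
    by (intro bounded_clinear_tendsto[OF S_clinear]) (simp add: embK_apply m_def)
  \<comment> \<open>The additional tensor factor and the additional step cancel:
    \<open>Suc n - Suc m = n - m\<close>, so both sides carry the same vacuum padding, also when the
    difference is truncated to 0.\<close>
  moreover have "b (Suc n) = S i (a n)" for n
  proof -
    have "hadj (slot 0) (insK [] (ks @ replicate (n - m) \<Omega>K) (u (HP h (\<epsilon> i))))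
        = C i (M h [] (ks @ replicate (n - m) \<Omega>K))"
      by (simp add: hadj_slot_insK hadj_isometry[OF u_clinear u_cinner] insP_apply C_apply)
    from u_adj_prod_C[OF this, of n] show ?thesis
      unfolding a_def b_def diff_Suc_Suc append_vac_insK append_vac_apply by (simp only: embP_C)
  qed
  moreover have "b \<longlonglongrightarrow> wt (embK (Suc m) (insK [] ks (u (HP h (\<epsilon> i)))))"
    unfolding b_def by (rule wt_limit[OF finite_power_insK]) (simp add: m_def)
  then have "(\<lambda>n. b (Suc n)) \<longlonglongrightarrow> wt (t i (HKK h (tensor_pad \<Omega>K TK ks)))"
    by (intro LIMSEQ_Suc) (simp add: embK_insK m_def t_apply)
  ultimately show ?thesis using LIMSEQ_unique by auto
qed

lemma wt_t: "wt (t i x) = S i (wt x)"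
proof (rule tensor_eqI[OF HKK bounded_clinear_compose[OF wt t_clinear] bounded_clinear_compose[OF S_clinear wt]])
  fix h y
  have tot: "closure (cspan (TK ` tail_seqs \<Omega>K)) = UNIV" using TK by (simp add: infinite_tensor_def)
  show "wt (t i (HKK h y)) = S i (wt (HKK h y))"
  proof (rule bounded_clinear_eqI[OF tot])
    show "bounded_clinear (\<lambda>y. wt (t i (HKK h y)))" "bounded_clinear (\<lambda>y. S i (wt (HKK h y)))"
      by (rule bounded_clinear_compose[OF wt bounded_clinear_compose[OF t_clinear bounded_clinear_tensor_right[OF HKK]]]
          bounded_clinear_compose[OF S_clinear bounded_clinear_compose[OF wt bounded_clinear_tensor_right[OF HKK]]])+
  next
    fix x assume "x \<in> TK ` tail_seqs \<Omega>K"
    then obtain f where f: "f \<in> tail_seqs \<Omega>K" "x = TK f" by blast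
    obtain ks where "TK f = tensor_pad \<Omega>K TK ks" using tail_seqs_eq_pad[OF f(1), of TK] by blast
    with f(2) have "x = tensor_pad \<Omega>K TK ks" by simp
    then show "wt (t i (HKK h x)) = S i (wt (HKK h x))" by (simp only: wt_t_pad)
  qed
qed

lemma tensor_pad_replicate: "tensor_pad \<Omega> T (replicate n \<Omega>) = T (\<lambda>_. \<Omega>)"
  unfolding tensor_pad_def by (rule arg_cong[of _ _ T]) auto

text \<open>Each step consumes one \<open>\<Omega>K\<close> and creates one
  \<open>\<Omega>P\<close>; \<open>r\<close> counts the \<K>-factors still left and must vary in the
  induction.\<close>

lemma u_adj_prod_vacuum:
  "u_adj_prod HP HK M u j (M \<Omega>H [] (replicate (j + r) \<Omega>K)) = M \<Omega>H (replicate j \<Omega>P) (replicate r \<Omega>K)"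
proof (induction j arbitrary: r)
  case (Suc j)
  have "u_adj_prod HP HK M u (Suc j) (M \<Omega>H [] (replicate (Suc j + r) \<Omega>K))
      = hadj (slot j) (M \<Omega>H (replicate j \<Omega>P) (\<Omega>K # replicate r \<Omega>K))"
    using Suc[of "Suc r"] by simp
  also have "\<dots> = hadj (slot j) (insK (replicate j \<Omega>P) (replicate r \<Omega>K) (HK \<Omega>H \<Omega>K))"
    by (simp only: insK_apply)
  also have "\<dots> = M \<Omega>H (replicate (Suc j) \<Omega>P) (replicate r \<Omega>K)"
    by (simp add: hadj_slot_insK hadj_u_vacuum insP_apply replicate_append_same)
  finally show ?case .
qed simp

text \<open>For this vector the sequence in the product formula is constant.\<close>

lemma wt_vacuum: "wt (\<iota> \<Omega>H) = HPP \<Omega>H (TP (\<lambda>_. \<Omega>P))"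
proof -
  have "embP n (u_adj_prod HP HK M u n (append_vac M \<Omega>K (n - 0) (M \<Omega>H [] []))) = HPP \<Omega>H (TP (\<lambda>_. \<Omega>P))" for n
    using u_adj_prod_vacuum[of n 0] by (simp add: append_vac_apply embP_apply tensor_pad_replicate)
  moreover have "embK 0 (M \<Omega>H [] []) = \<iota> \<Omega>H"
    by (simp add: embK_apply tensor_pad_def)
  ultimately have "(\<lambda>n :: nat. HPP \<Omega>H (TP (\<lambda>_. \<Omega>P))) \<longlonglongrightarrow> wt (\<iota> \<Omega>H)"
    using wt_limit[OF finite_power_base[of "[]" 0 \<Omega>H]] by simp
  then show ?thesis by (simp add: LIMSEQ_const_iff)
qed

section \<open>Compression to the final space and consequences of ergodicity\<close>

definition "J = HPP \<Omega>H"
definition "w' x = hadj J (wt x)"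

lemma J_clinear: "bounded_clinear J"
  unfolding J_def by (rule bounded_clinear_tensor_right[OF HPP])

lemma \<Omega>H_cinner: "cinner \<Omega>H \<Omega>H = 1"
  by (simp add: cinner_self \<Omega>H)

lemma J_cinner: "cinner (J x) (J y) = cinner x y"
  by (simp add: J_def hilbert_tensor_cinner[OF HPP] \<Omega>H_cinner)

lemma w'_clinear: "bounded_clinear w'"
  unfolding w'_def by (rule bounded_clinear_compose[OF bounded_clinear_hadj[OF J_clinear] wt])

text \<open>\<open>hadj J\<close> contracts the \<H>-factor with \<open>\<Omega>H\<close>, whereas
  \<open>S i\<close> acts on the other factor.\<close>

lemma hadj_J_S: "hadj J (S i x) = s i (hadj J x)"
proof (rule tensor_eqI[OF HPP bounded_clinear_compose[OF bounded_clinear_hadj[OF J_clinear] S_clinear]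
      bounded_clinear_compose[OF s_clinear bounded_clinear_hadj[OF J_clinear]]])
  have J: "hadj J (HPP h y) = cinner \<Omega>H h *\<^sub>C y" for h y
    by (rule cinner_ext, subst cinner_hadj_right[OF J_clinear])
      (simp add: J_def hilbert_tensor_cinner[OF HPP] cinner_scaleC_right)
  show "hadj J (S i (HPP h y)) = s i (hadj J (HPP h y))" for h y
    by (simp add: S_apply J bounded_clinear_scaleC[OF s_clinear])
qed

lemma w'_t: "w' (t i x) = s i (w' x)"
  by (simp add: w'_def wt_t hadj_J_S)

lemma w'_vacuum: "w' (\<iota> \<Omega>H) = TP (\<lambda>_. \<Omega>P)"
  using hadj_isometry[OF J_clinear J_cinner] by (simp add: w'_def wt_vacuum flip: J_def)

lemma \<iota>_clinear: "bounded_clinear (\<lambda>h. \<iota> h)"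
  by (rule bounded_clinear_tensor_left[OF HKK])

text \<open>By ergodicity the positive operators \<open>\<iota>\<^sup>* wt\<^sup>* wt \<iota>\<close> and \<open>\<iota>\<^sup>* w'\<^sup>* w' \<iota>\<close>, being fixed points of
  \<open>Z\<close>, are scalars, and their values at the vacuum show that both are the identity.\<close>

lemma wt_\<iota>_cinner: "cinner (wt (\<iota> h)) (wt (\<iota> h')) = cinner h h'"
proof -
  have "\<exists>c. \<forall>h h'. cinner (wt (\<iota> h)) (wt (\<iota> h')) = c * cinner h h'"
  proof (rule ergodic_intertwiner[OF A(1,3) S_cinner bounded_clinear_compose[OF wt \<iota>_clinear]])
    show "((\<lambda>i. S i (wt (\<iota> (hadj (A i) h)))) has_sum wt (\<iota> h)) UNIV" for h
      using bounded_clinear_has_sum[OF wt \<iota>_has_sum[of h]] by (simp add: wt_t)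
  qed
  then obtain c where c: "\<And>h h'. cinner (wt (\<iota> h)) (wt (\<iota> h')) = c * cinner h h'" by blast
  have "c = cinner (wt (\<iota> \<Omega>H)) (wt (\<iota> \<Omega>H))" by (simp add: c \<Omega>H_cinner)
  also have "\<dots> = 1"
    unfolding wt_vacuum hilbert_tensor_cinner[OF HPP]
    by (simp add: \<Omega>H_cinner) (simp add: cinner_self infinite_tensor_unit[OF TP])
  finally show ?thesis by (simp add: c)
qed

lemma w'_\<iota>_cinner: "cinner (w' (\<iota> h)) (w' (\<iota> h')) = cinner h h'"
proof -
  have "\<exists>c. \<forall>h h'. cinner (w' (\<iota> h)) (w' (\<iota> h')) = c * cinner h h'"
  proof (rule ergodic_intertwiner[OF A(1,3) s_cinner bounded_clinear_compose[OF w'_clinear \<iota>_clinear]])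
    show "((\<lambda>i. s i (w' (\<iota> (hadj (A i) h)))) has_sum w' (\<iota> h)) UNIV" for h
      using bounded_clinear_has_sum[OF w'_clinear \<iota>_has_sum[of h]] by (simp add: w'_t)
  qed
  then obtain c where c: "\<And>h h'. cinner (w' (\<iota> h)) (w' (\<iota> h')) = c * cinner h h'" by blast
  have "c = cinner (w' (\<iota> \<Omega>H)) (w' (\<iota> \<Omega>H))" by (simp add: c \<Omega>H_cinner)
  also have "\<dots> = 1"
    by (simp add: w'_vacuum cinner_self infinite_tensor_unit[OF TP])
  finally show ?thesis by (simp add: c)
qed

section \<open>The dilation space and unitarity of the intertwiner\<close>

abbreviation "words \<equiv> {foldr t \<alpha> (\<iota> h) |\<alpha> h. True}"
abbreviation "Hhat \<equiv> dilation_space t (\<lambda>h. \<iota> h)"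

lemma Hhat_eq: "Hhat = closure (cspan words)"
  by (simp add: dilation_space_def)

lemma Hhat_subspace: "cvec.subspace Hhat" and Hhat_closed: "closed Hhat"
  unfolding Hhat_eq by (intro csubspace_closure cvec.subspace_span closed_closure)+

lemma words_Hhat: "words \<subseteq> Hhat"
  unfolding Hhat_eq by (rule order_trans[OF cvec.span_superset closure_subset])

lemma \<iota>_Hhat: "\<iota> h \<in> Hhat"
  by (rule subsetD[OF words_Hhat]) (auto intro!: exI[of _ "[]"])

lemma Hhat_minimal:
  assumes "words \<subseteq> X" "closed X" "cvec.subspace X" shows "Hhat \<subseteq> X"
  unfolding Hhat_eq by (intro closure_minimal cvec.span_minimal assms)

lemma t_Hhat: "x \<in> Hhat \<Longrightarrow> t i x \<in> Hhat"
proof -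
  have "words \<subseteq> {x. t i x \<in> Hhat}"
  proof clarsimp
    fix \<alpha> h show "t i (foldr t \<alpha> (\<iota> h)) \<in> Hhat"
      by (rule subsetD[OF words_Hhat]) (auto intro!: exI[of _ "i # \<alpha>"])
  qed
  from Hhat_minimal[OF this bounded_clinear_vimage[OF t_clinear Hhat_closed Hhat_subspace]]
  show "x \<in> Hhat \<Longrightarrow> t i x \<in> Hhat" by blast
qed

text \<open>This says that \<open>wt\<close> maps \<open>Hhat\<close> into the range of
  \<open>J\<close>. It holds for words by induction: the range of \<open>J\<close> is invariant
  under every \<open>S i\<close>.\<close>

lemma wt_eq_J_w':
  assumes "x \<in> Hhat" shows "wt x = J (w' x)"
proof (rule bounded_clinear_eq_closure[OF wt bounded_clinear_compose[OF J_clinear w'_clinear] _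
      assms[unfolded Hhat_eq]])
  fix x assume "x \<in> words"
  then obtain \<alpha> h where x: "x = foldr t \<alpha> (\<iota> h)" by blast
  have "wt (foldr t \<alpha> (\<iota> h)) = J (w' (foldr t \<alpha> (\<iota> h)))"
  proof (induction \<alpha>)
    case Nil
    \<comment> \<open>\<open>hadj J\<close> preserves the norm of \<open>wt (\<iota> h)\<close>,
      since both \<open>wt\<close> and \<open>w'\<close> are isometric on the embedded copy of
      \<H>.\<close>
    have "J (hadj J (wt (\<iota> h))) = wt (\<iota> h)"
      by (rule isometry_range_if_norm_hadj[OF J_clinear J_cinner])
        (simp add: wt_\<iota>_cinner w'_\<iota>_cinner flip: w'_def)
    then show ?case by (simp add: w'_def)
  next
    case (Cons i \<alpha>)
    have "S i (J y) = J (s i y)" for y by (simp add: J_def S_apply)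
    then show ?case using Cons by (simp add: wt_t w'_t)
  qed
  then show "wt x = J (w' x)" by (simp add: x)
qed

text \<open>Inner products of words obey the same recursion before and after \<open>w'\<close>:
  equal first letters cancel, different ones give 0, and a letter facing an empty word becomes
  \<open>hadj (A i)\<close> on the other side. This reduces everything to
  \<open>w'_\<iota>_cinner\<close>.\<close>

lemma w'_words_cinner:
  "cinner (w' (foldr t \<alpha> (\<iota> h))) (w' (foldr t \<beta> (\<iota> h'))) = cinner (foldr t \<alpha> (\<iota> h)) (foldr t \<beta> (\<iota> h'))"
proof -
  have t_\<iota>: "cinner (t i x) (\<iota> h) = cinner x (\<iota> (hadj (A i) h))" for i x h
    by (rule cinner_has_sum_single[OF \<iota>_has_sum, where i = i]) (simp add: t_cinner)
  have s_\<iota>: "cinner (s i y) (w' (\<iota> h)) = cinner y (w' (\<iota> (hadj (A i) h)))" for i y h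
    by (rule cinner_has_sum_single[OF bounded_clinear_has_sum[OF w'_clinear \<iota>_has_sum], where i = i])
      (simp add: w'_t s_cinner)
  have left: "cinner (w' (foldr t \<alpha> (\<iota> h))) (w' (\<iota> h')) = cinner (foldr t \<alpha> (\<iota> h)) (\<iota> h')" for \<alpha> h h'
  proof (induction \<alpha> arbitrary: h')
    case Nil
    show ?case by (simp add: w'_\<iota>_cinner hilbert_tensor_cinner[OF HKK] cinner_self infinite_tensor_unit[OF TK])
  qed (simp add: w'_t t_\<iota> s_\<iota>)
  show ?thesis
  proof (induction \<alpha> arbitrary: \<beta> h)
    case Nil
    show ?case using left[of \<beta> h' h] by (metis cinner_commute foldr_Nil id_apply)
  next
    case (Cons i \<alpha>)
    show ?case
    proof (cases \<beta>)
      case Nil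
      show ?thesis using left[of "i # \<alpha>" h h'] by (simp add: Nil)
    next
      case (Cons j \<gamma>)
      then show ?thesis using Cons.IH[of h \<gamma>] by (simp add: w'_t s_cinner t_cinner)
    qed
  qed
qed

lemma w'_cinner:
  assumes "a \<in> Hhat" "b \<in> Hhat" shows "cinner (w' a) (w' b) = cinner a b"
proof -
  have "cinner (w' a) (w' b) = 1 * cinner a b"
    by (rule cinner_closure_form[OF w'_clinear w'_clinear _ assms[unfolded Hhat_eq]])
      (auto simp: w'_words_cinner)
  then show ?thesis by simp
qed

text \<open>Induction on the number of leading factors that may differ from
  \<open>\<Omega>P\<close>: the first factor is approximated by combinations of the
  \<open>\<epsilon> i\<close>, and prepending \<open>\<epsilon> i\<close> is
  \<open>s i\<close>.\<close>

lemma TP_in_closed_invariant: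
  assumes X: "closed X" "cvec.subspace X" and vac: "TP (\<lambda>_. \<Omega>P) \<in> X" and inv: "\<And>i x. x \<in> X \<Longrightarrow> s i x \<in> X"
  shows "x \<in> X"
proof -
  have tot: "closure (cspan (range \<epsilon>)) = UNIV" using \<epsilon> by (simp add: orthonormal_basis_def)
  have "TP f \<in> X" if "\<forall>n\<ge>N. f n = \<Omega>P" for f N
    using that
  proof (induction N arbitrary: f)
    case 0
    then have "f = (\<lambda>_. \<Omega>P)" by auto
    then show ?case using vac by simp
  next
    case (Suc N)
    define g where "g n = f (Suc n)" for n
    have g: "TP g \<in> X" "g \<in> tail_seqs \<Omega>P"
      using Suc by (auto simp: g_def tail_seqs_def intro!: exI[of _ N])
    have "f 0 \<in> {k. tensor_Cons \<Omega>P TP k (TP g) \<in> X}"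
      by (rule total_induct[OF tot _ bounded_clinear_vimage[OF bounded_clinear_tensor_left[OF s_hilbert_tensor] X]])
        (use inv[OF g(1)] in auto)
    moreover have "f = case_nat (f 0) g" by (rule ext) (simp add: g_def split: nat.split)
    ultimately show ?case using tensor_Cons_apply[OF TP g(2), of "f 0"] by simp
  qed
  then have "TP ` tail_seqs \<Omega>P \<subseteq> X" by (auto simp: tail_seqs_def)
  then show ?thesis
    using TP by (intro total_induct[OF _ _ X]) (auto simp: infinite_tensor_def)
qed

lemma w'_surj: "w' ` Hhat = UNIV"
proof -
  \<comment> \<open>An isometric image of a complete space is complete, which gives the closedness
    required by \<open>TP_in_closed_invariant\<close>.\<close>
  have "complete (w' ` Hhat)"
  proof (rule complete_isometric_image[where e = 1])
    show "subspace Hhat"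
      using Hhat_subspace unfolding subspace_def cvec.subspace_def by (simp add: scaleR_scaleC)
    show "\<forall>x\<in>Hhat. 1 * norm x \<le> norm (w' x)"
      by (simp add: norm_eq_if_cinner_eq[OF w'_cinner])
  qed (use Hhat_closed bounded_clinear_bounded_linear[OF w'_clinear] in \<open>auto simp: complete_eq_closed\<close>)
  then have 1: "closed (w' ` Hhat)" by (simp add: complete_eq_closed)
  have 2: "cvec.subspace (w' ` Hhat)"
    unfolding cvec.subspace_def
  proof (intro conjI ballI allI)
    show "0 \<in> w' ` Hhat"
      using Hhat_subspace bounded_clinear_zero[OF w'_clinear] by (metis cvec.subspace_0 imageI)
    show "x + y \<in> w' ` Hhat" if "x \<in> w' ` Hhat" "y \<in> w' ` Hhat" for x y
      using that by (auto simp flip: bounded_clinear_add[OF w'_clinear]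
          intro!: imageI cvec.subspace_add[OF Hhat_subspace])
    show "c *\<^sub>C x \<in> w' ` Hhat" if "x \<in> w' ` Hhat" for c x
      using that by (auto simp flip: bounded_clinear_scaleC[OF w'_clinear]
          intro!: imageI cvec.subspace_scale[OF Hhat_subspace])
  qed
  have 3: "TP (\<lambda>_. \<Omega>P) \<in> w' ` Hhat"
    using \<iota>_Hhat[of \<Omega>H] w'_vacuum by (metis imageI)
  have 4: "s i x \<in> w' ` Hhat" if "x \<in> w' ` Hhat" for i x
    using that by (auto simp flip: w'_t intro!: imageI t_Hhat)
  show ?thesis using TP_in_closed_invariant[OF 1 2 3 4] by blast
qed

lemma the_intertwiner:
  assumes "x \<in> Hhat" shows "(THE y. HPP \<Omega>H y = wt x) = w' x"
proof (rule the_equality)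
  show "HPP \<Omega>H (w' x) = wt x" using wt_eq_J_w'[OF assms] by (simp add: J_def)
  fix y assume "HPP \<Omega>H y = wt x"
  then have "J y = J (w' x)" using wt_eq_J_w'[OF assms] by (simp add: J_def)
  then show "y = w' x" by (metis hadj_isometry[OF J_clinear J_cinner])
qed

text \<open>Gohm's theorem on the infinite product formula.\<close>

theorem unitary_intertwiner:
  defines "w \<equiv> \<lambda>x. THE y. HPP \<Omega>H y = wt x"
  shows "unitary_on w Hhat UNIV" "x \<in> Hhat \<Longrightarrow> w (t i x) = s i (w x)" "w (\<iota> \<Omega>H) = TP (\<lambda>_. \<Omega>P)"
proof -
  have w: "w x = w' x" if "x \<in> Hhat" for x
    using the_intertwiner[OF that] by (simp add: w_def)
  have im: "w ` Hhat = UNIV" using w'_surj w by (simp add: image_def)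
  have "w (x + y) = w x + w y" if "x \<in> Hhat" "y \<in> Hhat" for x y
    using that cvec.subspace_add[OF Hhat_subspace that] by (simp add: w bounded_clinear_add[OF w'_clinear])
  moreover have "w (c *\<^sub>C x) = c *\<^sub>C w x" if "x \<in> Hhat" for c x
    using that cvec.subspace_scale[OF Hhat_subspace that, of c] by (simp add: w bounded_clinear_scaleC[OF w'_clinear])
  moreover have "norm (w x) = norm x" if "x \<in> Hhat" for x 
    using that by (simp add: w norm_eq_if_cinner_eq[OF w'_cinner])
  ultimately show "unitary_on w Hhat UNIV" using im by (auto simp: unitary_on_def isometry_on_def)
  show "w (t i x) = s i (w x)" if "x \<in> Hhat" using that by (simp add: w t_Hhat w'_t)
  show "w (\<iota> \<Omega>H) = TP (\<lambda>_. \<Omega>P)" by (simp add: w \<iota>_Hhat w'_vacuum)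
qed

end

section \<open>The characteristic function\<close>

lemma unitary_on_compose:
  "unitary_on T X Y \<Longrightarrow> unitary_on S Y Z \<Longrightarrow> unitary_on (\<lambda>x. S (T x)) X Z"
  unfolding unitary_on_def isometry_on_def by (auto simp: image_iff)

lemma unitary_on_inj:
  assumes "unitary_on T X Y" "cvec.subspace X" shows "inj_on T X"
proof (rule inj_onI)
  fix x y assume xy: "x \<in> X" "y \<in> X" "T x = T y"
  have T: "isometry_on T X Y" using assms(1) by (simp add: unitary_on_def)
  \<comment> \<open>\<open>isometry_on\<close> speaks of sums and multiples only, so the difference
    is written as \<open>x + (-1) *\<^sub>C y\<close>.\<close>
  have m: "(-1) *\<^sub>C y \<in> X" by (rule cvec.subspace_scale[OF assms(2) xy(2)])
  have eq: "a + (-1) *\<^sub>C b = a - b" for a b :: "'c :: complex_hilbert"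
    by (simp add: cvec.scale_minus_left scaleC_one)
  have "T (x + (-1) *\<^sub>C y) = T x + (-1) *\<^sub>C T y"
    using T xy m unfolding isometry_on_def by metis
  moreover have "x + (-1) *\<^sub>C y \<in> X"
    by (rule cvec.subspace_add[OF assms(2) xy(1) m])
  ultimately have "norm (x + (-1) *\<^sub>C y) = norm (T x + (-1) *\<^sub>C T y)"
    using T unfolding isometry_on_def by metis
  then show "x = y" using xy(3) by (simp add: eq)
qed

lemma unitary_on_inv_into:
  assumes T: "unitary_on T X Y" and X: "cvec.subspace X"
  shows "unitary_on (inv_into X T) Y X"
proof -
  have T': "\<And>x y. x \<in> X \<Longrightarrow> y \<in> X \<Longrightarrow> T (x + y) = T x + T y" "\<And>c x. x \<in> X \<Longrightarrow> T (c *\<^sub>C x) = c *\<^sub>C T x"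
    "\<And>x. x \<in> X \<Longrightarrow> norm (T x) = norm x" "T ` X = Y"
    using T by (auto simp: unitary_on_def isometry_on_def)
  have inv: "inv_into X T (T x) = x" if "x \<in> X" for x
    by (rule inv_into_f_f[OF unitary_on_inj[OF T X] that])
  have 1: "inv_into X T (T x + T y) = inv_into X T (T x) + inv_into X T (T y)" if "x \<in> X" "y \<in> X" for x y
    using that inv[OF cvec.subspace_add[OF X that]] by (simp add: T'(1) inv)
  have 2: "inv_into X T (c *\<^sub>C T x) = c *\<^sub>C inv_into X T (T x)" if "x \<in> X" for c x
    using that inv[OF cvec.subspace_scale[OF X that, of c]] by (simp add: T'(2) inv)
  have "inv_into X T ` Y = X"
    using inv by (force simp: T'(4)[symmetric] image_image)
  moreover have "isometry_on (inv_into X T) Y X"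
    unfolding isometry_on_def T'(4)[symmetric] by (auto simp: 1 2 inv T'(3))
  ultimately show ?thesis by (simp add: unitary_on_def)
qed

text \<open>Prepending a unit basis vector preserves \<open>list_cinner\<close>, so
  \<open>creation F i\<close> is an isometry, and then so are the prescribed values on elementary
  tensors.\<close>

lemma creation_id_clinear:
  assumes F: "full_fock F" and G: "hilbert_tensor G"
  shows "bounded_clinear (creation_id F G i)"
proof -
  have tot: "closure (cspan (range F)) = UNIV" using F by (simp add: full_fock_def)
  have e: "cinner (l2_single i 1) (l2_single i (1 :: complex)) = 1"
  proof -
    have "((\<lambda>j. cinner (l2_nth (l2_single i 1) j) (l2_nth (l2_single i (1 :: complex)) j)) has_sum 1) UNIV"
      by (rule has_sum_finite_neutralI[of "{i}"]) (auto simp: l2_single.rep_eq cinner_complex_def)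
    then show ?thesis unfolding cinner_l2_def by (rule infsumI)
  qed
  have "\<exists>S. bounded_clinear S \<and> (\<forall>xs\<in>UNIV. S (F xs) = F (l2_single i 1 # xs))"
    by (rule bounded_clinear_total_ext[where c = 1, OF tot]) (use F e in \<open>auto simp: full_fock_def\<close>)
  then have ex: "\<exists>S. bounded_clinear S \<and> (\<forall>xs. S (F xs) = F (l2_single i 1 # xs))" by auto
  have c: "bounded_clinear (creation F i)" "\<forall>xs. creation F i (F xs) = F (l2_single i 1 # xs)"
    unfolding creation_def by (rule bounded_clinear_the[OF tot ex]; auto)+
  have ip: "cinner (creation F i g) (creation F i g') = 1 * cinner g g'" for g g'
    by (rule cinner_total_form[OF tot c(1) c(1)]) (use F e c(2) in \<open>auto simp: full_fock_def\<close>)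
  have "creation_id F G i = tensor_lift G (\<lambda>g v. G (creation F i g) v)"
    by (simp add: creation_id_def tensor_lift_def)
  then show ?thesis
    using bounded_clinear_tensor_lift[OF G, of "\<lambda>g v. G (creation F i g) v" 1]
    by (simp add: hilbert_tensor_cinner[OF G] ip)
qed

theorem mainTheorem5:
  fixes A :: "'i :: countable \<Rightarrow> 'h :: complex_hilbert \<Rightarrow> 'h"
    and \<omega> :: "'i \<Rightarrow> complex"
    and \<Omega>H :: 'h
    and \<epsilon> :: "'i \<Rightarrow> 'p :: complex_hilbert" and \<Omega>P :: 'p
    and \<Omega>K :: "'k :: complex_hilbert"
    and HP :: "'h \<Rightarrow> 'p \<Rightarrow> 'hp :: complex_hilbert"
    and HK :: "'h \<Rightarrow> 'k \<Rightarrow> 'hk :: complex_hilbert"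
    and TK :: "(nat \<Rightarrow> 'k) \<Rightarrow> 'kk :: complex_hilbert"
    and TP :: "(nat \<Rightarrow> 'p) \<Rightarrow> 'pp :: complex_hilbert"
    and HKK :: "'h \<Rightarrow> 'kk \<Rightarrow> 'hkk :: complex_hilbert"
    and HPP :: "'h \<Rightarrow> 'pp \<Rightarrow> 'hpp :: complex_hilbert"
    and M\<^sub>0 :: "'h \<Rightarrow> 'p list \<Rightarrow> 'k list \<Rightarrow> 'f :: complex_hilbert"
    and F :: "('i, complex) l2 list \<Rightarrow> 'g :: complex_hilbert"
    and GA :: "'g \<Rightarrow> ('i, 'h) l2 \<Rightarrow> 'ga :: complex_hilbert"
    and G\<omega> :: "'g \<Rightarrow> ('i, complex) l2 \<Rightarrow> 'gw :: complex_hilbert"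
    and u :: "'hp \<Rightarrow> 'hk"
    and t :: "'i \<Rightarrow> 'hkk \<Rightarrow> 'hkk" and s :: "'i \<Rightarrow> 'pp \<Rightarrow> 'pp"
    and \<iota> :: "'h \<Rightarrow> 'hkk" and Hhat :: "'hkk set"
    and V :: "'i \<Rightarrow> 'h \<times> 'ga \<Rightarrow> 'h \<times> 'ga"
    and Vt :: "'i \<Rightarrow> complex \<times> 'gw \<Rightarrow> complex \<times> 'gw"
    and \<Gamma>D\<^sub>A :: "'ga set" and \<Gamma>D\<^sub>\<omega> :: "'gw set"
    and wt :: "'hkk \<Rightarrow> 'hpp" and w :: "'hkk \<Rightarrow> 'pp"
    and \<Gamma>\<^sub>A :: "'hkk \<Rightarrow> 'h \<times> 'ga" and \<Gamma>\<^sub>\<omega> :: "'pp \<Rightarrow> complex \<times> 'gw"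
    and W :: "'h \<times> 'ga \<Rightarrow> complex \<times> 'gw" and M\<Theta> :: "'ga \<Rightarrow> 'gw"
  assumes d: "CARD('i) \<noteq> 1"
    and separable: "\<exists>D :: 'h set. countable D \<and> closure D = UNIV"
    \<comment> \<open>the row contraction\<close>
    and A: "row_contraction A" "coisometric A" "ergodic A"
    and \<Omega>H: "norm \<Omega>H = 1"
    and \<omega>: "((\<lambda>i. (cmod (\<omega> i))\<^sup>2) has_sum 1) UNIV"
    and eigen: "\<And>i. hadj (A i) \<Omega>H = cnj (\<omega> i) *\<^sub>C \<Omega>H"
    \<comment> \<open>realizations of the tensor products and Fock spaces\<close>
    and HP: "hilbert_tensor HP" and HK: "hilbert_tensor HK"
    and TK: "infinite_tensor \<Omega>K TK" and TP: "infinite_tensor \<Omega>P TP"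
    and HKK: "hilbert_tensor HKK" and HPP: "hilbert_tensor HPP"
    and M\<^sub>0: "mixed_tensor M\<^sub>0"
    and F: "full_fock F" and GA: "hilbert_tensor GA" and G\<omega>: "hilbert_tensor G\<omega>"
    \<comment> \<open>the tensor product dilation\<close>
    and \<epsilon>: "orthonormal_basis \<epsilon>"
    and \<Omega>P: "((\<lambda>i. cnj (\<omega> i) *\<^sub>C \<epsilon> i) has_sum \<Omega>P) UNIV"
    and \<Omega>K: "norm \<Omega>K = 1"
    and u: "isometry_on u UNIV UNIV"
      "\<And>h. ((\<lambda>i. HP (hadj (A i) h) (\<epsilon> i)) has_sum hadj u (HK h \<Omega>K)) UNIV"
    and t: "t = dilation_t HP HK HKK \<Omega>K TK \<epsilon> u"
    and s: "s = (\<lambda>i. tensor_Cons \<Omega>P TP (\<epsilon> i))"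
    and \<iota>: "\<iota> = (\<lambda>h. HKK h (TK (\<lambda>_. \<Omega>K)))"
    and Hhat: "Hhat = dilation_space t \<iota>"
    \<comment> \<open>the infinite product formula\<close>
    and wt: "bounded_clinear wt"
      "\<And>m \<xi>. \<xi> \<in> finite_power M\<^sub>0 m \<Longrightarrow>
         (\<lambda>n. embed_P M\<^sub>0 HPP \<Omega>P TP n (u_adj_prod HP HK M\<^sub>0 u n (append_vac M\<^sub>0 \<Omega>K (n - m) \<xi>)))
           \<longlonglongrightarrow> wt (embed_K M\<^sub>0 HKK \<Omega>K TK m \<xi>)"
    and w: "w = (\<lambda>x. THE y. HPP \<Omega>H y = wt x)"
    \<comment> \<open>the Fock space dilations\<close>
    and V: "V = popescu_V F GA A" and Vt: "Vt = popescu_V F G\<omega> (\<lambda>i z. \<omega> i * z)"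
    and \<Gamma>D\<^sub>A: "\<Gamma>D\<^sub>A = fock_tensor GA (defect_space A)"
    and \<Gamma>D\<^sub>\<omega>: "\<Gamma>D\<^sub>\<omega> = fock_tensor G\<omega> (defect_space (\<lambda>i z. \<omega> i * z))"
    and \<Gamma>\<^sub>A: "unitary_on \<Gamma>\<^sub>A Hhat (UNIV \<times> \<Gamma>D\<^sub>A)" "\<And>h. \<Gamma>\<^sub>A (\<iota> h) = (h, 0)"
      "\<And>i x. x \<in> Hhat \<Longrightarrow> V i (\<Gamma>\<^sub>A x) = \<Gamma>\<^sub>A (t i x)"
    and \<Gamma>\<^sub>\<omega>: "unitary_on \<Gamma>\<^sub>\<omega> UNIV (UNIV \<times> \<Gamma>D\<^sub>\<omega>)" "\<Gamma>\<^sub>\<omega> (TP (\<lambda>_. \<Omega>P)) = (1, 0)"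
      "\<And>i x. Vt i (\<Gamma>\<^sub>\<omega> x) = \<Gamma>\<^sub>\<omega> (s i x)"
    and W: "W = (\<lambda>x. \<Gamma>\<^sub>\<omega> (w (inv_into Hhat \<Gamma>\<^sub>A x)))"
    and M\<Theta>: "M\<Theta> = (\<lambda>\<xi>. snd (W (0, \<xi>)))"
  shows "unitary_on W (UNIV \<times> \<Gamma>D\<^sub>A) (UNIV \<times> \<Gamma>D\<^sub>\<omega>)
    \<and> (\<forall>i. \<forall>x \<in> UNIV \<times> \<Gamma>D\<^sub>A. W (V i x) = Vt i (W x))
    \<and> W (\<Omega>H, 0) = (1, 0)
    \<and> (\<forall>\<xi>\<in>\<Gamma>D\<^sub>A. W (0, \<xi>) = (0, M\<Theta> \<xi>))
    \<and> isometry_on M\<Theta> \<Gamma>D\<^sub>A \<Gamma>D\<^sub>\<omega>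
    \<and> (\<forall>i. \<forall>\<xi>\<in>\<Gamma>D\<^sub>A. M\<Theta> (creation_id F GA i \<xi>) = creation_id F G\<omega> i (M\<Theta> \<xi>))"
proof -
  interpret tensor_dilation A \<omega> \<Omega>H \<epsilon> \<Omega>P \<Omega>K HP HK TK TP HKK HPP M\<^sub>0 u wt
    by unfold_locales (use assms in \<open>auto simp: row_contraction_def\<close>)
  have Hhat': "Hhat = dilation_space (dilation_t HP HK HKK \<Omega>K TK \<epsilon> u) (\<lambda>h. HKK h (TK (\<lambda>_. \<Omega>K)))"
    unfolding Hhat t \<iota> ..
  note sub = Hhat_subspace[folded Hhat']
  have w_unitary: "unitary_on w Hhat UNIV" and w_t: "\<And>i x. x \<in> Hhat \<Longrightarrow> w (t i x) = s i (w x)"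
    and w_vac: "w (\<iota> \<Omega>H) = TP (\<lambda>_. \<Omega>P)"
    using unitary_intertwiner unfolding w Hhat' t s \<iota> by simp_all
  have t_Hhat': "t i x \<in> Hhat" if "x \<in> Hhat" for i x
    using t_Hhat that unfolding Hhat' t by simp
  have \<iota>_Hhat': "\<iota> h \<in> Hhat" for h
    using \<iota>_Hhat unfolding Hhat' \<iota> by simp
  have inv: "inv_into Hhat \<Gamma>\<^sub>A (\<Gamma>\<^sub>A x) = x" if "x \<in> Hhat" for x
    by (rule inv_into_f_f[OF unitary_on_inj[OF \<Gamma>\<^sub>A(1) sub] that])
  have W_\<Gamma>\<^sub>A: "W (\<Gamma>\<^sub>A x) = \<Gamma>\<^sub>\<omega> (w x)" if "x \<in> Hhat" for x
    by (simp add: W inv[OF that])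
  have W_unitary: "unitary_on W (UNIV \<times> \<Gamma>D\<^sub>A) (UNIV \<times> \<Gamma>D\<^sub>\<omega>)"
    unfolding W
    by (intro unitary_on_compose[OF unitary_on_inv_into[OF \<Gamma>\<^sub>A(1) sub]]
        unitary_on_compose[OF w_unitary \<Gamma>\<^sub>\<omega>(1)])
  have range_\<Gamma>\<^sub>A: "\<exists>a\<in>Hhat. x = \<Gamma>\<^sub>A a" if "x \<in> UNIV \<times> \<Gamma>D\<^sub>A" for x
    using \<Gamma>\<^sub>A(1) that unfolding unitary_on_def by blast
  \<comment> \<open>Writing \<open>x\<close> as the image of some \<open>a\<close> in
    \<open>Hhat\<close> removes the inverse from \<open>W\<close> and reduces the claim to the three
    given intertwining relations.\<close>
  have W_V: "W (V i x) = Vt i (W x)" if "x \<in> UNIV \<times> \<Gamma>D\<^sub>A" for i x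
    using range_\<Gamma>\<^sub>A[OF that] by (auto simp: \<Gamma>\<^sub>A(3) \<Gamma>\<^sub>\<omega>(3) W_\<Gamma>\<^sub>A t_Hhat' w_t)
  have W_vac: "W (\<Omega>H, 0) = (1, 0)"
    using W_\<Gamma>\<^sub>A[OF \<iota>_Hhat', of \<Omega>H] by (simp add: \<Gamma>\<^sub>A(2) w_vac \<Gamma>\<^sub>\<omega>(2))
  have W_iso: "isometry_on W (UNIV \<times> \<Gamma>D\<^sub>A) (UNIV \<times> \<Gamma>D\<^sub>\<omega>)"
    using W_unitary by (simp add: unitary_on_def)
  have sub\<Gamma>: "cvec.subspace \<Gamma>D\<^sub>A"
    unfolding \<Gamma>D\<^sub>A fock_tensor_def by (intro csubspace_closure cvec.subspace_span)
  then have sub_prod: "cvec.subspace (UNIV \<times> \<Gamma>D\<^sub>A :: ('h \<times> 'ga) set)"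
    by (auto simp: cvec.subspace_def scaleC_prod_def zero_prod_def)
  \<comment> \<open>\<open>(0, \<xi>)\<close> is orthogonal to \<open>(\<Omega>H, 0)\<close>, and
    \<open>W\<close> preserves inner products; the inner product of the image with
    \<open>(1, 0)\<close> is its first component.\<close>
  have W_snd: "W (0, \<xi>) = (0, M\<Theta> \<xi>)" if "\<xi> \<in> \<Gamma>D\<^sub>A" for \<xi>
  proof -
    have "cinner (W (\<Omega>H, 0)) (W (0, \<xi>)) = cinner (\<Omega>H, 0) (0, \<xi>)"
      by (rule isometry_on_cinner[OF W_iso sub_prod]) (use that sub\<Gamma> in \<open>auto simp: cvec.subspace_0\<close>)
    then have "fst (W (0, \<xi>)) = 0"
      by (simp add: W_vac cinner_prod_def cinner_complex_def)
    then show ?thesis by (simp add: M\<Theta> prod_eq_iff)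
  qed
  have "isometry_on M\<Theta> \<Gamma>D\<^sub>A \<Gamma>D\<^sub>\<omega>"
    unfolding isometry_on_def
  proof (intro conjI ballI allI)
    fix x y c assume x: "x \<in> \<Gamma>D\<^sub>A"
    have "W ((0, x) + (0, y)) = W (0, x) + W (0, y)" if "y \<in> \<Gamma>D\<^sub>A"
      using W_iso x that unfolding isometry_on_def by blast
    then show "M\<Theta> (x + y) = M\<Theta> x + M\<Theta> y" if "y \<in> \<Gamma>D\<^sub>A"
      using that by (simp add: M\<Theta>)
    have "W (c *\<^sub>C (0, x)) = c *\<^sub>C W (0, x)"
      using W_iso x unfolding isometry_on_def by blast
    then show "M\<Theta> (c *\<^sub>C x) = c *\<^sub>C M\<Theta> x"
      by (simp add: M\<Theta> scaleC_prod_def)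
    have "norm (W (0, x)) = norm (0 :: 'h, x)"
      using W_iso x unfolding isometry_on_def by blast
    then show "norm (M\<Theta> x) = norm x" by (simp add: W_snd[OF x] norm_prod_def)
  next
    show "M\<Theta> ` \<Gamma>D\<^sub>A \<subseteq> \<Gamma>D\<^sub>\<omega>"
    proof clarify
      fix x assume x: "x \<in> \<Gamma>D\<^sub>A"
      then have "W (0, x) \<in> UNIV \<times> \<Gamma>D\<^sub>\<omega>" using W_iso unfolding isometry_on_def by blast
      then show "M\<Theta> x \<in> \<Gamma>D\<^sub>\<omega>" by (simp add: W_snd[OF x])
    qed
  qed
  moreover have "M\<Theta> (creation_id F GA i \<xi>) = creation_id F G\<omega> i (M\<Theta> \<xi>)" if \<xi>: "\<xi> \<in> \<Gamma>D\<^sub>A" for i \<xi>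
  proof -
    have 0: "\<Gamma>\<^sub>A 0 = 0" "\<Gamma>\<^sub>\<omega> 0 = 0" "0 \<in> Hhat"
      using \<Gamma>\<^sub>A(1) \<Gamma>\<^sub>\<omega>(1) cvec.subspace_0[OF sub] unfolding unitary_on_def isometry_on_def
      by (metis norm_eq_zero UNIV_I)+
    \<comment> \<open>The intertwining relations at \<open>0\<close> show that \<open>V i\<close> and \<open>Vt i\<close> map \<open>0\<close> to \<open>0\<close>; this
      disposes of the defect terms without any use of the square root in \<open>defect\<close>.\<close>
    have "V i 0 = 0"
      using \<Gamma>\<^sub>A(3)[OF 0(3), of i] by (simp add: 0 t bounded_clinear_zero[OF t_clinear])
    then have defA: "GA (F []) (defect A (l2_single i 0)) = 0"
      by (simp add: V popescu_V_def zero_prod_def bounded_clinear_zero[OF creation_id_clinear[OF F GA]])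
    have "Vt i 0 = 0"
      using \<Gamma>\<^sub>\<omega>(3)[of i 0] by (simp add: 0 s bounded_clinear_zero[OF s_clinear])
    then have def\<omega>: "G\<omega> (F []) (defect (\<lambda>i z. \<omega> i * z) (l2_single i 0)) = 0"
      by (simp add: Vt popescu_V_def zero_prod_def bounded_clinear_zero[OF creation_id_clinear[OF F G\<omega>]])
    \<comment> \<open>On vectors with first component 0 both dilations reduce to creation operators,
      so the relation for \<open>W\<close> becomes multi-analyticity in the second
      component.\<close>
    have "V i (0, \<xi>) = (0, creation_id F GA i \<xi>)"
      using A(1) by (simp add: V popescu_V_def defA row_contraction_def bounded_clinear_zero)
    moreover have "Vt i (0, M\<Theta> \<xi>) = (0, creation_id F G\<omega> i (M\<Theta> \<xi>))"
      by (simp add: Vt popescu_V_def def\<omega>)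
    ultimately have "W (0, creation_id F GA i \<xi>) = (0, creation_id F G\<omega> i (M\<Theta> \<xi>))"
      using W_V[of "(0, \<xi>)" i] \<xi> by (simp add: W_snd)
    then show ?thesis by (simp add: M\<Theta>)
  qed
  ultimately show ?thesis
    using W_unitary W_V W_vac W_snd by blast
qed

end
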